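(* Fix $1\le p_0<q<q_0\le\infty$ and let $\mathbb B=(B_Q)_{Q\in\mathcal Q}$ satisfy conditions (b) and (c) below (commutativity is not assumed). Assume further that for all cubes $R\subset Q$ and all $f$, $$A_RA_Qf(x)=A_Qf(x)\quad\text{for a.e. }x\in2R.$$ Let $f\in L^{p_0}_{loc}(\mathbb R^n)$ and let $a$ be a functional such that $(\fint_{2^kQ}|B_Qf|^{p_0})^{1/p_0}\le a(2^kQ)$ for every integer $k\ge0$ and every cube $Q$. If $a\in D_q$, then for every cube $Q$, $$\|B_Qf\|_{L^{q,\infty},Q}\le C\sum_{k\ge1}\eta_k\,a(2^kQ),$$ where $\eta_1=1$, $\eta_k=\alpha_k2^{kn/p_0}$ for $k\ge2$, and $C$ is independent of $Q$ and $f$.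
   Context: Cubes $Q=\prod_i[a_i,a_i+\ell(Q))$; $\lambda Q$ is the concentric cube of sidelength $\lambda\ell(Q)$; $\mathcal Q$ is the set of all cubes; $\fint_Eg=|E|^{-1}\int_Eg$; $\|g\|_{L^{q,\infty},Q}=\sup_{t>0}t(|\{x\in Q:|g(x)|>t\}|/|Q|)^{1/q}$. A functional is a map $a:\mathcal Q\to[0,\infty)$. $\mathbb B=(B_Q)_{Q\in\mathcal Q}$ are linear operators defined on $L^{p_0}_{loc}(\mathbb R^n)$ and $A_Q=I-B_Q$. Condition (b): there is $C_{p_0}$ with $\|B_Qf\|_{L^{p_0}(\mathbb R^n)}\le C_{p_0}\|f\|_{L^{p_0}(\mathbb R^n)}$ for all cubes $Q$. Condition (c): there are $\alpha_k\ge0$, $k\ge2$, with $\sum_k2^{kn/p_0}\alpha_k<\infty$, such that for every cube $Q$, $(\fint_{2Q}|A_Q(f\chi_{4Q})|^{q_0})^{1/q_0}\le\alpha_2(\fint_{4Q}|f|^{p_0})^{1/p_0}$ and, for all $j\ge1$, $(\fint_{2^jQ}|A_Q(f\chi_{\mathbb R^n\setminus2^{j+1}Q})|^{q_0})^{1/q_0}\le\sum_{k\ge2}\alpha_{k+j}(\fint_{2^{k+j}Q}|f|^{p_0})^{1/p_0}$ (essential suprema when $q_0=\infty$). $a\in D_q$ means there is $C\ge1$ such that $\sum_ia(Q_i)^q|Q_i|\le C^qa(Q)^q|Q|$ for every cube $Q$ and every family of pairwise disjoint cubes $Q_i\subset Q$. *)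

theory Defs
  imports "HOL-Analysis.Analysis"
begin

text \<open>A cube is encoded by its lower corner a and side length l > 0:
  Q = prod_i [a_i, a_i + l).\<close>
type_synonym 'n cube = "(real^'n) \<times> real"

definition is_cube :: "'n::finite cube \<Rightarrow> bool" where
  "is_cube Q \<longleftrightarrow> snd Q > 0"

definition cube_set :: "'n::finite cube \<Rightarrow> (real^'n) set" where
  "cube_set Q = {x. \<forall>i. fst Q $ i \<le> x $ i \<and> x $ i < fst Q $ i + snd Q}"

text \<open>Concentric dilation lambda Q (same centre, side length lambda * l).\<close>
definition dil :: "real \<Rightarrow> 'n::finite cube \<Rightarrow> 'n cube" where
  "dil lam Q = ((\<chi> i. fst Q $ i + (1 - lam) * snd Q / 2), lam * snd Q)"

definition ennroot :: "real \<Rightarrow> ennreal \<Rightarrow> ennreal" where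
  "ennroot p x = (if x = top then top else ennreal (enn2real x powr (1 / p)))"

definition avgp :: "real \<Rightarrow> (real^'n::finite) set \<Rightarrow> (real^'n \<Rightarrow> complex) \<Rightarrow> ennreal" where
  "avgp p E g = ennroot p ((\<integral>\<^sup>+x\<in>E. ennreal (cmod (g x) powr p) \<partial>lebesgue) / emeasure lebesgue E)"

definition esssup_on :: "(real^'n::finite) set \<Rightarrow> (real^'n \<Rightarrow> complex) \<Rightarrow> ennreal" where
  "esssup_on E g = Inf {t. AE x in lebesgue. x \<in> E \<longrightarrow> ennreal (cmod (g x)) \<le> t}"

definition avgq :: "ennreal \<Rightarrow> (real^'n::finite) set \<Rightarrow> (real^'n \<Rightarrow> complex) \<Rightarrow> ennreal" where
  "avgq q E g = (if q = top then esssup_on E g else avgp (enn2real q) E g)"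

definition lpnorm :: "real \<Rightarrow> (real^'n::finite \<Rightarrow> complex) \<Rightarrow> ennreal" where
  "lpnorm p g = ennroot p (\<integral>\<^sup>+x. ennreal (cmod (g x) powr p) \<partial>lebesgue)"

definition inLp :: "real \<Rightarrow> (real^'n::finite \<Rightarrow> complex) \<Rightarrow> bool" where
  "inLp p g \<longleftrightarrow> g \<in> borel_measurable lebesgue \<and> lpnorm p g < top"

definition locLp :: "real \<Rightarrow> (real^'n::finite \<Rightarrow> complex) \<Rightarrow> bool" where
  "locLp p g \<longleftrightarrow> g \<in> borel_measurable lebesgue \<and>
     (\<forall>K. compact K \<longrightarrow> (\<integral>\<^sup>+x\<in>K. ennreal (cmod (g x) powr p) \<partial>lebesgue) < top)"

definition weak_norm :: "real \<Rightarrow> 'n::finite cube \<Rightarrow> (real^'n \<Rightarrow> complex) \<Rightarrow> ennreal" where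
  "weak_norm q Q g = (SUP t\<in>{0<..}. ennreal t *
      ennroot q (emeasure lebesgue {x \<in> cube_set Q. cmod (g x) > t} / emeasure lebesgue (cube_set Q)))"

definition Aop :: "('n::finite cube \<Rightarrow> (real^'n \<Rightarrow> complex) \<Rightarrow> (real^'n \<Rightarrow> complex))
     \<Rightarrow> 'n cube \<Rightarrow> (real^'n \<Rightarrow> complex) \<Rightarrow> (real^'n \<Rightarrow> complex)" where
  "Aop B Q f = (\<lambda>x. f x - B Q f x)"

definition lin_family :: "real \<Rightarrow> ('n::finite cube \<Rightarrow> (real^'n \<Rightarrow> complex) \<Rightarrow> (real^'n \<Rightarrow> complex)) \<Rightarrow> bool" where
  "lin_family p0 B \<longleftrightarrow> (\<forall>Q. is_cube Q \<longrightarrow>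
     (\<forall>f. locLp p0 f \<longrightarrow> locLp p0 (B Q f)) \<and>
     (\<forall>f g. locLp p0 f \<longrightarrow> locLp p0 g \<longrightarrow> (AE x in lebesgue. f x = g x) \<longrightarrow>
        (AE x in lebesgue. B Q f x = B Q g x)) \<and>
     (\<forall>f g. locLp p0 f \<longrightarrow> locLp p0 g \<longrightarrow>
        (AE x in lebesgue. B Q (\<lambda>y. f y + g y) x = B Q f x + B Q g x)) \<and>
     (\<forall>f c. locLp p0 f \<longrightarrow> (AE x in lebesgue. B Q (\<lambda>y. c * f y) x = c * B Q f x)))"

definition cond_b :: "real \<Rightarrow> real \<Rightarrow> ('n::finite cube \<Rightarrow> (real^'n \<Rightarrow> complex) \<Rightarrow> (real^'n \<Rightarrow> complex)) \<Rightarrow> bool" where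
  "cond_b p0 Cp0 B \<longleftrightarrow> (\<forall>Q f. is_cube Q \<longrightarrow> inLp p0 f \<longrightarrow>
      lpnorm p0 (B Q f) \<le> ennreal Cp0 * lpnorm p0 f)"

definition cond_c :: "real \<Rightarrow> ennreal \<Rightarrow> (nat \<Rightarrow> real) \<Rightarrow> ('n::finite cube \<Rightarrow> (real^'n \<Rightarrow> complex) \<Rightarrow> (real^'n \<Rightarrow> complex)) \<Rightarrow> bool" where
  "cond_c p0 q0 \<alpha> B \<longleftrightarrow>
     (\<forall>k\<ge>2. \<alpha> k \<ge> 0) \<and>
     summable (\<lambda>k. 2 powr (real (k + 2) * real CARD('n) / p0) * \<alpha> (k + 2)) \<and>
     (\<forall>Q f. is_cube Q \<longrightarrow> locLp p0 f \<longrightarrow>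
        avgq q0 (cube_set (dil 2 Q)) (Aop B Q (\<lambda>x. indicator (cube_set (dil 4 Q)) x * f x))
          \<le> ennreal (\<alpha> 2) * avgp p0 (cube_set (dil 4 Q)) f) \<and>
     (\<forall>Q f j. is_cube Q \<longrightarrow> locLp p0 f \<longrightarrow> j \<ge> 1 \<longrightarrow>
        avgq q0 (cube_set (dil (2 ^ j) Q))
            (Aop B Q (\<lambda>x. indicator (UNIV - cube_set (dil (2 ^ (j + 1)) Q)) x * f x))
          \<le> (\<Sum>k. ennreal (\<alpha> (k + 2 + j)) * avgp p0 (cube_set (dil (2 ^ (k + 2 + j)) Q)) f))"

definition in_Dq_with :: "real \<Rightarrow> real \<Rightarrow> ('n::finite cube \<Rightarrow> real) \<Rightarrow> bool" where
  "in_Dq_with q C a \<longleftrightarrow> C \<ge> 1 \<and>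
     (\<forall>Q F. is_cube Q \<longrightarrow> (\<forall>R\<in>F. is_cube R \<and> cube_set R \<subseteq> cube_set Q) \<longrightarrow>
        disjoint_family_on cube_set F \<longrightarrow>
        (\<integral>\<^sup>+R. ennreal (a R powr q * measure lebesgue (cube_set R)) \<partial>count_space F)
          \<le> ennreal (C powr q * a Q powr q * measure lebesgue (cube_set Q)))"

definition in_Dq :: "real \<Rightarrow> ('n::finite cube \<Rightarrow> real) \<Rightarrow> bool" where
  "in_Dq q a \<longleftrightarrow> (\<exists>C. in_Dq_with q C a)"

definition eta :: "nat \<Rightarrow> real \<Rightarrow> (nat \<Rightarrow> real) \<Rightarrow> nat \<Rightarrow> real" where
  "eta n p0 \<alpha> k = (if k = 1 then 1 else \<alpha> k * 2 powr (real k * real n / p0))"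

end

theory Submission
  imports Defs
begin

text \<open>A good-lambda argument for h = B_Q f. Call a dyadic subcube P of Q heavy at level t if the
  p0-average of h over 2P exceeds t, and let R be a maximal heavy cube, of generation m. Dilates
  2^k R with k \<le> m sit in the doubled (light) ancestors of R, so h has average at most C t on them;
  the larger ones sit in 2^k Q, at the price of the factor 2^(kn/p0) that appears in eta_k.
  On 2R the absorption hypothesis gives h = B_R f + A_R(h 1_{4R}) + A_R(h 1_{outside 4R}). The last
  two terms have L^r averages of order t for some finite r > q, by (c), once t dominates the sum
  of the eta_k a(2^k Q). The first has p0-average at most a(2R), which is either at most gamma t,
  or R belongs to a family whose total measure is controlled by D_q after a Vitali selection among
  the 2R. This bounds the heavy set at level K t by a multiple less than K^(-q) of the one at
  level t plus a term of order t^(-q); iteration gives the weak-type decay.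
  Dyadic generations are truncated at N, so that all families are finite, with bounds uniform
  in N.\<close>

subsection \<open>Cubes and dyadic subcubes\<close>

text \<open>The obstacle is that \<open>h\<close> is only locally in L^p0, which by itself gives
  decay t^(-p0), whereas t^(-q) with q > p0 is wanted. The gain comes from the two A_R terms: they
  are controlled in L^r with r > q, so passing from level t to K t costs them K^(-r), which beats
  K^(-q) for large K. The term B_R f has only the exponent p0 and contributes (gamma/K)^p0; since
  K^(q-p0) grows, a large K cannot make it harmless, so its smallness must come from gamma, chosen
  after K. The cubes with a(2R) > gamma t are not estimated at all: they are counted whole, and D_q
  pays for them with the power t^(-q). The iteration needs no a priori finiteness of the weak norm,
  because its starting value, the measure of the heavy set at the first level, is at most |Q|.
  Passing from heavy cubes back to the size of \<open>h\<close> needs only a statement of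
  differentiation type, that |h| is at most 2^(n+1) t almost everywhere off the heavy cubes, and
  this follows from regularity of Lebesgue measure.\<close>

lemma snd_dil [simp]: "snd (dil l Q) = l * snd Q"
  and fst_dil [simp]: "fst (dil l Q) $ i = fst Q $ i + (1 - l) * snd Q / 2"
  by (simp_all add: dil_def)

lemma is_cube_dil [simp]: "l > 0 \<Longrightarrow> is_cube Q \<Longrightarrow> is_cube (dil l Q)"
  by (simp add: is_cube_def)

lemma cube_subset_iff:
  fixes R Q :: "'n::finite cube"
  assumes "is_cube R"
  shows "cube_set R \<subseteq> cube_set Q \<longleftrightarrow>
    (\<forall>i. fst Q $ i \<le> fst R $ i \<and> fst R $ i + snd R \<le> fst Q $ i + snd Q)"
proof
  assume sub: "cube_set R \<subseteq> cube_set Q"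
  have R: "snd R > 0" using assms by (simp add: is_cube_def)
  have "fst R \<in> cube_set R" using R by (simp add: cube_set_def)
  with sub have low: "fst Q $ i \<le> fst R $ i" for i by (auto simp: cube_set_def)
  have "fst R $ i + snd R \<le> fst Q $ i + snd Q" for i
  proof (rule ccontr)
    assume c: "\<not> ?thesis"
    \<comment> \<open>The corner of R, moved only in coordinate i to the right face of Q (or left
      alone if it already lies beyond): still in R, no longer in Q.\<close>
    define x where "x = (\<chi> j. if j = i then max (fst R $ i) (fst Q $ i + snd Q) else fst R $ j)"
    have "x \<in> cube_set R" using c R by (auto simp: cube_set_def x_def)
    moreover have "x \<notin> cube_set Q" by (auto simp: cube_set_def x_def intro!: exI[of _ i])
    ultimately show False using sub by blast
  qed
  with low show "\<forall>i. fst Q $ i \<le> fst R $ i \<and> fst R $ i + snd R \<le> fst Q $ i + snd Q" by blast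
next
  assume H: "\<forall>i. fst Q $ i \<le> fst R $ i \<and> fst R $ i + snd R \<le> fst Q $ i + snd Q"
  show "cube_set R \<subseteq> cube_set Q"
  proof
    fix x assume x: "x \<in> cube_set R"
    have "fst Q $ i \<le> x $ i \<and> x $ i < fst Q $ i + snd Q" for i
      using spec[OF H, of i] x unfolding cube_set_def by (auto dest!: spec[of _ i])
    then show "x \<in> cube_set Q" by (simp add: cube_set_def)
  qed
qed

text \<open>Dilation by l adds a margin of (l-1)/2 side lengths on every side, and the larger cube
  receives the larger margin. For l < 1 the margins are negative and the argument breaks
  down.\<close>

lemma cube_set_dil_mono:
  assumes "is_cube R" "cube_set R \<subseteq> cube_set Q" "1 \<le> l"
  shows "cube_set (dil l R) \<subseteq> cube_set (dil l Q)"
proof -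
  have l: "is_cube (dil l R)" using assms by simp
  have H: "fst Q $ i \<le> fst R $ i" "fst R $ i + snd R \<le> fst Q $ i + snd Q" for i
    using assms(2) cube_subset_iff[OF assms(1)] by auto
  show ?thesis unfolding cube_subset_iff[OF l]
  proof
    fix i
    have "snd R \<le> snd Q" using H[of i] by linarith
    then have "(l - 1) * snd R \<le> (l - 1) * snd Q" using assms(3) by (intro mult_left_mono) auto
    then show "fst (dil l Q) $ i \<le> fst (dil l R) $ i \<and>
        fst (dil l R) $ i + snd (dil l R) \<le> fst (dil l Q) $ i + snd (dil l Q)"
      using H[of i] by (simp add: field_simps)
  qed
qed

lemma cube_subset_dil:
  assumes "is_cube Q" "1 \<le> l" shows "cube_set Q \<subseteq> cube_set (dil l Q)"
proof -
  have "0 \<le> (l - 1) * snd Q" using assms by (simp add: is_cube_def)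
  then show ?thesis unfolding cube_subset_iff[OF assms(1)] by (simp add: field_simps)
qed

text \<open>The dilate of R has the side length of T and its centre in T, so it leaves T by at most
  half a side, which is exactly the margin of the double. With l = 2^k and T the k-th dyadic
  ancestor this is what makes testing on doubles effective.\<close>

lemma cube_set_dil_ancestor:
  assumes "is_cube R" "cube_set R \<subseteq> cube_set T" "snd T = l * snd R" "0 < l"
  shows "cube_set (dil l R) \<subseteq> cube_set (dil 2 T)"
proof -
  have l: "is_cube (dil l R)" using assms by simp
  have R: "snd R > 0" using assms by (simp add: is_cube_def)
  have H: "fst T $ i \<le> fst R $ i" "fst R $ i + snd R \<le> fst T $ i + snd T" for i
    using assms(2) cube_subset_iff[OF assms(1)] by auto
  have "fst (dil 2 T) $ i \<le> fst (dil l R) $ i \<and>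
      fst (dil l R) $ i + snd (dil l R) \<le> fst (dil 2 T) $ i + snd (dil 2 T)" for i
    using H[of i] R assms(3) by (simp add: field_simps)
  then show ?thesis unfolding cube_subset_iff[OF l] by blast
qed

lemma cube_set_box:
  fixes Q :: "'n::finite cube"
  shows "box (fst Q) (\<chi> i. fst Q $ i + snd Q) \<subseteq> cube_set Q"
    and "cube_set Q \<subseteq> cbox (fst Q) (\<chi> i. fst Q $ i + snd Q)"
  by (auto simp: cube_set_def mem_box_cart less_imp_le)

lemma
  fixes Q :: "'n::finite cube"
  assumes "is_cube Q"
  shows lmeasurable_cube: "cube_set Q \<in> lmeasurable"
    and measure_cube: "measure lebesgue (cube_set Q) = snd Q ^ CARD('n)"
proof -
  let ?b = "(\<chi> i. fst Q $ i + snd Q) :: real^'n"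
  have neg: "negligible (cbox (fst Q) ?b - cube_set Q)"
    by (rule negligible_subset[OF negligible_frontier_interval[of "fst Q" ?b]])
      (use cube_set_box[of Q] in blast)
  have eq: "cube_set Q = cbox (fst Q) ?b - (cbox (fst Q) ?b - cube_set Q)"
    using cube_set_box(2)[of Q] by blast
  show "cube_set Q \<in> lmeasurable"
    by (subst eq) (intro fmeasurable.Diff lmeasurable_cbox negligible_imp_measurable neg)
  have "measure lebesgue (cube_set Q) = measure lebesgue (cbox (fst Q) ?b)"
    by (subst eq) (rule measure_Diff_null_set, use neg in \<open>auto simp: negligible_iff_null_sets\<close>)
  also have "\<dots> = snd Q ^ CARD('n)"
  proof -
    have "cbox (fst Q) ?b \<noteq> {}" using assms
      by (auto simp: is_cube_def interval_ne_empty_cart less_imp_le)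
    then show ?thesis by (simp add: content_cbox_cart)
  qed
  finally show "measure lebesgue (cube_set Q) = snd Q ^ CARD('n)" .
qed

lemma sets_cube: "is_cube Q \<Longrightarrow> cube_set Q \<in> sets lebesgue"
  using lmeasurable_cube by blast

lemma emeasure_cube:
  assumes "is_cube (Q::'n::finite cube)"
  shows "emeasure lebesgue (cube_set Q) = ennreal (snd Q ^ CARD('n))"
  using emeasure_eq_measure2[OF lmeasurable_cube[OF assms]] measure_cube[OF assms] by simp

section \<open>Dyadic grid of a cube and maximal dyadic cubes\<close>

definition dyad :: "'n::finite cube \<Rightarrow> nat \<Rightarrow> real^'n \<Rightarrow> 'n cube" where
  "dyad Q m x = ((\<chi> i. fst Q $ i + of_int \<lfloor>2 ^ m * (x $ i - fst Q $ i) / snd Q\<rfloor> * (snd Q / 2 ^ m)),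
     snd Q / 2 ^ m)"

lemma snd_dyad [simp]: "snd (dyad Q m x) = snd Q / 2 ^ m"
  by (simp add: dyad_def)

lemma is_cube_dyad [simp]: "is_cube Q \<Longrightarrow> is_cube (dyad Q m x)"
  by (simp add: is_cube_def)

text \<open>Cubes are indexed by a point instead of an integer vector, so that the ancestors of
  \<open>dyad Q m x\<close> are \<open>dyad Q m' x\<close> with the same x. Membership then means
  equality of floor vectors, which reduces nesting and disjointness to integer arithmetic. The grid
  fills the whole space; x in Q is demanded separately where needed.\<close>

lemma mem_dyad_iff:
  assumes "is_cube Q"
  shows "y \<in> cube_set (dyad Q m x) \<longleftrightarrow>
    (\<forall>i. \<lfloor>2 ^ m * (y $ i - fst Q $ i) / snd Q\<rfloor> = \<lfloor>2 ^ m * (x $ i - fst Q $ i) / snd Q\<rfloor>)"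
proof -
  have Q: "snd Q > 0" using assms by (simp add: is_cube_def)
  have "a + of_int k * (snd Q / 2 ^ m) \<le> z \<and> z < a + of_int k * (snd Q / 2 ^ m) + snd Q / 2 ^ m
      \<longleftrightarrow> \<lfloor>2 ^ m * (z - a) / snd Q\<rfloor> = k" for a z :: real and k :: int
    unfolding floor_eq_iff using Q by (auto simp: field_simps)
  then show ?thesis by (simp add: cube_set_def dyad_def)
qed

lemma mem_dyad: "is_cube Q \<Longrightarrow> x \<in> cube_set (dyad Q m x)"
  by (simp add: mem_dyad_iff)

text \<open>The floor at a coarser generation is the fine floor divided by 2^(m-m') with integer
  division, so a fine cube determines all its ancestors.\<close>

lemma dyad_coarser_eq:
  assumes "is_cube Q" "y \<in> cube_set (dyad Q m x)" "m' \<le> m"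
  shows "dyad Q m' y = dyad Q m' x"
proof -
  have coarse: "\<lfloor>2 ^ m' * (z - a) / snd Q\<rfloor> = \<lfloor>2 ^ m * (z - a) / snd Q\<rfloor> div 2 ^ (m - m')"
    for z a :: real
  proof -
    have "2 ^ m = (2::real) ^ m' * 2 ^ (m - m')"
      using assms(3) by (simp flip: power_add)
    then have "2 ^ m' * (z - a) / snd Q = (2 ^ m * (z - a) / snd Q) / real_of_int (2 ^ (m - m'))"
      by simp
    then show ?thesis by (metis floor_divide_real_eq_div zero_le_numeral zero_le_power)
  qed
  have "\<lfloor>2 ^ m' * (y $ i - fst Q $ i) / snd Q\<rfloor> = \<lfloor>2 ^ m' * (x $ i - fst Q $ i) / snd Q\<rfloor>" for i
    using assms(2) unfolding mem_dyad_iff[OF assms(1)] coarse by simp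
  then show ?thesis by (simp add: dyad_def)
qed

lemma dyad_mono:
  assumes "is_cube Q" "m' \<le> m"
  shows "cube_set (dyad Q m x) \<subseteq> cube_set (dyad Q m' x)"
  using dyad_coarser_eq[OF assms(1) _ assms(2)] mem_dyad[OF assms(1)] by (metis subsetI)

lemma dyad_0:
  assumes "is_cube Q" "x \<in> cube_set Q"
  shows "dyad Q 0 x = Q"
proof -
  have "\<lfloor>(x $ i - fst Q $ i) / snd Q\<rfloor> = 0" for i
    unfolding floor_eq_iff using assms by (auto simp: is_cube_def cube_set_def field_simps)
  then show ?thesis by (simp add: dyad_def prod_eq_iff vec_eq_iff)
qed

lemma dyad_subset:
  assumes "is_cube Q" "x \<in> cube_set Q"
  shows "cube_set (dyad Q m x) \<subseteq> cube_set Q"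
  using dyad_mono[OF assms(1), of 0 m x] dyad_0[OF assms] by simp

text \<open>The cube depends on x only through its floor vector, which for x in Q ranges over a
  finite product of integer intervals.\<close>

lemma finite_dyads:
  fixes Q :: "'n::finite cube"
  assumes "is_cube Q"
  shows "finite (dyad Q m ` cube_set Q)"
proof -
  let ?k = "\<lambda>x (i::'n). \<lfloor>2 ^ m * (x $ i - fst Q $ i) / snd Q\<rfloor>"
  have "?k x i \<in> {0..2 ^ m}" if "x \<in> cube_set Q" for x i
  proof -
    have "0 \<le> (x $ i - fst Q $ i) / snd Q \<and> (x $ i - fst Q $ i) / snd Q \<le> 1"
      using that assms by (auto simp: is_cube_def cube_set_def field_simps less_imp_le)
    then have "0 \<le> 2 ^ m * (x $ i - fst Q $ i) / snd Q \<and> 2 ^ m * (x $ i - fst Q $ i) / snd Q \<le> 2 ^ m"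
      by (metis mult.right_neutral mult_left_mono mult_nonneg_nonneg times_divide_eq_right
        zero_le_numeral zero_le_power)
    then show ?thesis by (auto simp: le_floor_iff floor_le_iff)
  qed
  then have "?k ` cube_set Q \<subseteq> (\<Pi>\<^sub>E i\<in>UNIV. {0..2 ^ m})" by auto
  then have "finite (?k ` cube_set Q)"
    by (rule finite_subset) (intro finite_PiE, auto)
  moreover have "dyad Q m ` cube_set Q =
      (\<lambda>k. ((\<chi> i. fst Q $ i + of_int (k i) * (snd Q / 2 ^ m)), snd Q / 2 ^ m)) ` ?k ` cube_set Q"
    by (simp add: image_image dyad_def)
  ultimately show ?thesis by simp
qed

text \<open>The maximal bad cubes, described as the first bad ones on the branch of a point. The cap
  N bounds the generation but does not enter the maximality clause, so the family grows with
  N.\<close>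

definition stopping :: "'n::finite cube \<Rightarrow> nat \<Rightarrow> ('n cube \<Rightarrow> bool) \<Rightarrow> 'n cube set" where
  "stopping Q N bad = {dyad Q m x | m x. x \<in> cube_set Q \<and> m \<le> N \<and> bad (dyad Q m x) \<and>
     (\<forall>m'<m. \<not> bad (dyad Q m' x))}"

lemma stoppingE:
  assumes "R \<in> stopping Q N bad"
  obtains m x where "R = dyad Q m x" "x \<in> cube_set Q" "m \<le> N" "bad (dyad Q m x)"
    "\<And>m'. m' < m \<Longrightarrow> \<not> bad (dyad Q m' x)"
  using assms unfolding stopping_def by blast

lemma is_cube_stopping: "is_cube Q \<Longrightarrow> R \<in> stopping Q N bad \<Longrightarrow> is_cube R"
  by (auto elim!: stoppingE)

lemma stopping_subset: "is_cube Q \<Longrightarrow> R \<in> stopping Q N bad \<Longrightarrow> cube_set R \<subseteq> cube_set Q"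
  by (metis stoppingE dyad_subset)

lemma finite_stopping:
  assumes "is_cube Q" shows "finite (stopping Q N bad)"
proof (rule finite_subset)
  show "stopping Q N bad \<subseteq> (\<Union>m\<le>N. dyad Q m ` cube_set Q)"
    by (auto simp: stopping_def)
  show "finite (\<Union>m\<le>N. dyad Q m ` cube_set Q)" using finite_dyads[OF assms] by auto
qed

lemma exists_stopping:
  assumes "is_cube Q" "x \<in> cube_set Q" "m \<le> N" "bad (dyad Q m x)"
  obtains R where "R \<in> stopping Q N bad" "cube_set (dyad Q m x) \<subseteq> cube_set R"
proof -
  define m' where "m' = (LEAST k. bad (dyad Q k x))"
  have "bad (dyad Q m' x)" "m' \<le> m" and "\<And>k. k < m' \<Longrightarrow> \<not> bad (dyad Q k x)"
    unfolding m'_def by (fact LeastI[of "\<lambda>k. bad (dyad Q k x)", OF assms(4)])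
      (fact Least_le[of "\<lambda>k. bad (dyad Q k x)", OF assms(4)], fact not_less_Least)
  then have "dyad Q m' x \<in> stopping Q N bad"
    using assms unfolding stopping_def by (blast intro: le_trans)
  moreover have "cube_set (dyad Q m x) \<subseteq> cube_set (dyad Q m' x)"
    using dyad_mono[OF assms(1) \<open>m' \<le> m\<close>] .
  ultimately show ?thesis using that by blast
qed

text \<open>Through a common point y both cubes become members of the one branch
  \<open>dyad Q k y\<close>, and a branch has only one first bad generation.\<close>

lemma disjoint_stopping:
  assumes "is_cube Q"
  shows "disjoint_family_on cube_set (stopping Q N bad)"
proof -
  have "R = R'" if RR: "R \<in> stopping Q N bad" "R' \<in> stopping Q N bad" "y \<in> cube_set R" "y \<in> cube_set R'"
    for R R' y
  proof -
    obtain m x where R: "R = dyad Q m x" "bad (dyad Q m x)" "\<And>k. k < m \<Longrightarrow> \<not> bad (dyad Q k x)"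
      using RR(1) by (auto elim: stoppingE)
    obtain m' x' where R': "R' = dyad Q m' x'" "bad (dyad Q m' x')"
        "\<And>k. k < m' \<Longrightarrow> \<not> bad (dyad Q k x')"
      using RR(2) by (auto elim: stoppingE)
    have c: "k \<le> m \<Longrightarrow> dyad Q k x = dyad Q k y" "k \<le> m' \<Longrightarrow> dyad Q k x' = dyad Q k y" for k
      using dyad_coarser_eq[OF assms, of y] RR(3,4) R(1) R'(1) by simp_all
    have "\<not> m < m'" using R'(3)[of m] R(2) c by auto
    moreover have "\<not> m' < m" using R(3)[of m'] R'(2) c by auto
    ultimately have "m = m'" by simp
    then show ?thesis using R(1) R'(1) c by simp
  qed
  then show ?thesis by (auto simp: disjoint_family_on_def)
qed

text \<open>Greedy selection: take a largest cube M, discard everything that meets it, and recurse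
  on the rest. A discarded cube is no larger than M and meets M, hence lies in 3M. Finiteness lets
  an actual maximum be taken, so the factor is exactly 3.\<close>

lemma Vitali_cubes:
  fixes F :: "'n::finite cube set"
  assumes "finite F" "\<And>P. P \<in> F \<Longrightarrow> is_cube P"
  obtains G where "G \<subseteq> F" "disjoint_family_on cube_set G"
    "(\<Union>P\<in>F. cube_set P) \<subseteq> (\<Union>P\<in>G. cube_set (dil 3 P))"
proof -
  have "\<exists>G\<subseteq>F. disjoint_family_on cube_set G \<and>
      (\<Union>P\<in>F. cube_set P) \<subseteq> (\<Union>P\<in>G. cube_set (dil 3 P))"
    using assms
  proof (induction F rule: finite_psubset_induct)
    case (psubset F)
    show ?case
    proof (cases "F = {}")
      case True then show ?thesis by (auto simp: disjoint_family_on_def)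
    next
      case False
      obtain M where M: "M \<in> F" "\<And>P. P \<in> F \<Longrightarrow> snd P \<le> snd M"
      proof -
        have "Max (snd ` F) \<in> snd ` F" using False psubset.hyps by simp
        then obtain M where "M \<in> F" "snd M = Max (snd ` F)" by auto
        then show ?thesis using that psubset.hyps by simp
      qed
      define F' where "F' = {P \<in> F. cube_set P \<inter> cube_set M = {}}"
      have "fst M \<in> cube_set M" using psubset.prems[OF M(1)] by (simp add: cube_set_def is_cube_def)
      then have "F' \<subset> F" using M(1) by (auto simp: F'_def)
      then obtain G where G: "G \<subseteq> F'" "disjoint_family_on cube_set G"
          "(\<Union>P\<in>F'. cube_set P) \<subseteq> (\<Union>P\<in>G. cube_set (dil 3 P))"
        using psubset.IH[of F'] psubset.prems by blast
      have near: "cube_set P \<subseteq> cube_set (dil 3 M)" if P: "P \<in> F" "P \<notin> F'" for P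
      proof -
        obtain y where y: "y \<in> cube_set P" "y \<in> cube_set M" using P by (auto simp: F'_def)
        show ?thesis unfolding cube_subset_iff[OF psubset.prems[OF P(1)]]
        proof
          fix i
          have "fst P $ i \<le> y $ i" "y $ i < fst P $ i + snd P" "fst M $ i \<le> y $ i"
              "y $ i < fst M $ i + snd M"
            using y by (auto simp: cube_set_def)
          then show "fst (dil 3 M) $ i \<le> fst P $ i \<and> fst P $ i + snd P \<le> fst (dil 3 M) $ i + snd (dil 3 M)"
            using M(2)[OF P(1)] by simp
        qed
      qed
      have "disjoint_family_on cube_set (insert M G)"
        using G(1,2) by (auto simp: disjoint_family_on_def F'_def)
      moreover have "(\<Union>P\<in>F. cube_set P) \<subseteq> (\<Union>P\<in>insert M G. cube_set (dil 3 P))"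
        using near G(3) by blast
      moreover have "insert M G \<subseteq> F" using G(1) M(1) by (auto simp: F'_def)
      ultimately show ?thesis by blast
    qed
  qed
  then show ?thesis using that by blast
qed

text \<open>The selection is made among the doubles, since both heaviness and the values
  \<open>a (dil 2 R)\<close> refer to doubles and their contributions can be added only over
  disjoint sets. Injectivity of doubling carries the selected family back to the original
  cubes.\<close>

lemma Vitali_measure:
  fixes F :: "'n::finite cube set"
  assumes "finite F" "\<And>P. P \<in> F \<Longrightarrow> is_cube P"
  obtains G where "G \<subseteq> F" "disjoint_family_on (\<lambda>P. cube_set (dil 2 P)) G"
    "measure lebesgue (\<Union>P\<in>F. cube_set P)
      \<le> 3 ^ CARD('n) * (\<Sum>P\<in>G. measure lebesgue (cube_set (dil 2 P)))"
proof -
  obtain G' where G': "G' \<subseteq> dil 2 ` F" "disjoint_family_on cube_set G'"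
    "(\<Union>P\<in>dil 2 ` F. cube_set P) \<subseteq> (\<Union>P\<in>G'. cube_set (dil 3 P))"
    using Vitali_cubes[of "dil 2 ` F"] assms by force
  obtain G where G: "G \<subseteq> F" "G' = dil 2 ` G" using G'(1) subset_imageE by metis
  have fin: "finite G" using G(1) assms(1) finite_subset by blast
  have cube: "is_cube P" if "P \<in> G" for P using that G(1) assms(2) by blast
  have inj: "inj_on (dil 2) (UNIV :: 'n cube set)"
    by (rule injI) (auto simp: dil_def prod_eq_iff vec_eq_iff)
  have "measure lebesgue (\<Union>P\<in>F. cube_set P) \<le> measure lebesgue (\<Union>P\<in>G. cube_set (dil 3 (dil 2 P)))"
  proof (rule measure_mono_fmeasurable)
    have "(\<Union>P\<in>F. cube_set P) \<subseteq> (\<Union>P\<in>F. cube_set (dil 2 P))"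
      using cube_subset_dil[of _ 2] assms(2) by fastforce
    also have "\<dots> \<subseteq> (\<Union>P\<in>G. cube_set (dil 3 (dil 2 P)))" using G'(3) G(2) by simp
    finally show "(\<Union>P\<in>F. cube_set P) \<subseteq> \<dots>" .
    show "(\<Union>P\<in>F. cube_set P) \<in> sets lebesgue"
      using assms by (intro sets.finite_UN) (auto intro: sets_cube)
    show "(\<Union>P\<in>G. cube_set (dil 3 (dil 2 P))) \<in> lmeasurable"
      using fin cube by (intro fmeasurable.finite_UN) (auto intro: lmeasurable_cube)
  qed
  also have "\<dots> \<le> (\<Sum>P\<in>G. measure lebesgue (cube_set (dil 3 (dil 2 P))))"
    using cube by (intro measure_UNION_le fin) (auto intro: sets_cube)
  also have "\<dots> = 3 ^ CARD('n) * (\<Sum>P\<in>G. measure lebesgue (cube_set (dil 2 P)))"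
    unfolding sum_distrib_left
  proof (intro sum.cong refl)
    fix P assume "P \<in> G"
    then show "measure lebesgue (cube_set (dil 3 (dil 2 P)))
        = 3 ^ CARD('n) * measure lebesgue (cube_set (dil 2 P))"
      using cube[of P] power_mult_distrib[of 3 "2 * snd P" "CARD('n)"] by (simp add: measure_cube)
  qed
  finally have "measure lebesgue (\<Union>P\<in>F. cube_set P)
      \<le> 3 ^ CARD('n) * (\<Sum>P\<in>G. measure lebesgue (cube_set (dil 2 P)))" .
  moreover have "disjoint_family_on (\<lambda>P. cube_set (dil 2 P)) G"
    using G'(2) unfolding G(2) disjoint_family_on_def by (simp add: inj_eq[OF inj])
  ultimately show ?thesis using that G(1) by blast
qed


subsection \<open>Averages\<close>

lemma ennroot_le_iff:
  assumes "p > 0" "c \<ge> 0"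
  shows "ennroot p x \<le> ennreal c \<longleftrightarrow> x \<le> ennreal (c powr p)"
proof (cases x)
  case (real r)
  have "r powr (1 / p) \<le> c \<longleftrightarrow> r \<le> c powr p"
  proof
    assume "r powr (1 / p) \<le> c"
    then have "(r powr (1 / p)) powr p \<le> c powr p" using assms by (intro powr_mono2) auto
    then show "r \<le> c powr p" using assms real by (simp add: powr_powr)
  next
    assume "r \<le> c powr p"
    then have "r powr (1 / p) \<le> (c powr p) powr (1 / p)" using assms real by (intro powr_mono2) auto
    then show "r powr (1 / p) \<le> c" using assms by (simp add: powr_powr)
  qed
  then show ?thesis using real assms by (simp add: ennroot_def)
next
  case top
  then show ?thesis by (simp add: ennroot_def top_unique)
qed

text \<open>The unnormalised integral of |g|^p. It is monotone in the set and avoids roots and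
  quotients in \<open>ennreal\<close>, so estimates are made on it and translated by
  \<open>avgp_le_iff\<close>.\<close>

definition pint :: "real \<Rightarrow> (real^'n::finite) set \<Rightarrow> (real^'n \<Rightarrow> complex) \<Rightarrow> ennreal" where
  "pint p E g = (\<integral>\<^sup>+x\<in>E. ennreal (cmod (g x) powr p) \<partial>lebesgue)"

lemma pint_mono: "E \<subseteq> E' \<Longrightarrow> pint p E g \<le> pint p E' g"
  unfolding pint_def by (intro nn_integral_mono) (auto simp: indicator_def)

lemma measure_cube_pos: "is_cube Q \<Longrightarrow> 0 < measure lebesgue (cube_set Q)"
  by (simp add: measure_cube is_cube_def)

lemma emeasure_cube_measure:
  "is_cube Q \<Longrightarrow> emeasure lebesgue (cube_set Q) = ennreal (measure lebesgue (cube_set Q))"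
  by (simp add: emeasure_cube measure_cube)

lemma avgp_le_iff:
  assumes "is_cube Q" "p > 0" "c \<ge> 0"
  shows "avgp p (cube_set Q) g \<le> ennreal c \<longleftrightarrow>
    pint p (cube_set Q) g \<le> ennreal (c powr p * measure lebesgue (cube_set Q))"
proof -
  let ?v = "measure lebesgue (cube_set Q)"
  have v: "?v > 0" using measure_cube_pos[OF assms(1)] .
  have "x / ennreal ?v \<le> ennreal d \<longleftrightarrow> x \<le> ennreal (d * ?v)" if "d \<ge> 0" for x d
  proof (cases x)
    case (real r)
    then show ?thesis using v that by (simp add: divide_ennreal pos_divide_le_eq)
  next
    case top
    then show ?thesis by (simp add: ennreal_top_divide top_unique)
  qed
  then show ?thesis
    unfolding avgp_def ennroot_le_iff[OF assms(2,3)] pint_def[symmetric]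
      emeasure_cube_measure[OF assms(1)] by simp
qed

text \<open>Treats finite and infinite q0 alike by passing to one finite exponent r > q: r = q0 if
  q0 is finite, r = q + 1 otherwise. The slack c < c' avoids asking whether the infimum defining the
  essential supremum is attained.\<close>

lemma avgq_imp_pint:
  fixes q :: real and q0 :: ennreal
  assumes "ennreal q < q0" "0 < q"
  obtains r where "q < r" and
    "\<And>(Q :: 'n::finite cube) g c c'. is_cube Q \<Longrightarrow> 0 \<le> c \<Longrightarrow> c < c' \<Longrightarrow>
      avgq q0 (cube_set Q) g \<le> ennreal c \<Longrightarrow>
      pint r (cube_set Q) g \<le> ennreal (c' powr r * measure lebesgue (cube_set Q))"
proof (cases q0)
  case (real r)
  have r: "q < r" using assms real by (simp add: ennreal_less_iff)
  show ?thesis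
  proof (rule that[OF r])
    fix Q :: "'n cube" and g and c c' :: real
    assume A: "is_cube Q" "0 \<le> c" "c < c'" "avgq q0 (cube_set Q) g \<le> ennreal c"
    have "avgp r (cube_set Q) g \<le> ennreal c'"
      using A real by (auto simp: avgq_def intro: order_trans)
    then show "pint r (cube_set Q) g \<le> ennreal (c' powr r * measure lebesgue (cube_set Q))"
      using avgp_le_iff[of Q r c' g] A r assms by simp
  qed
next
  case top
  show ?thesis
  proof (rule that[of "q + 1"])
    fix Q :: "'n cube" and g and c c' :: real
    assume A: "is_cube Q" "0 \<le> c" "c < c'" "avgq q0 (cube_set Q) g \<le> ennreal c"
    have "Inf {t. AE x in lebesgue. x \<in> cube_set Q \<longrightarrow> ennreal (cmod (g x)) \<le> t} < ennreal c'"
      using A top by (simp add: avgq_def esssup_on_def ennreal_lessI le_less_trans)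
    then obtain t where t: "t < ennreal c'"
        "AE x in lebesgue. x \<in> cube_set Q \<longrightarrow> ennreal (cmod (g x)) \<le> t"
      unfolding Inf_less_iff by auto
    have "pint (q + 1) (cube_set Q) g
        \<le> (\<integral>\<^sup>+x. ennreal (c' powr (q + 1)) * indicator (cube_set Q) x \<partial>lebesgue)"
      unfolding pint_def
    proof (rule nn_integral_mono_AE, use t(2) in eventually_elim)
      case (elim x)
      show ?case
      proof (cases "x \<in> cube_set Q")
        case True
        then have "ennreal (cmod (g x)) \<le> ennreal c'" using elim t(1) by (meson less_imp_le order_trans)
        then have "cmod (g x) \<le> c'" using A by (simp add: ennreal_le_iff2)
        then have "cmod (g x) powr (q + 1) \<le> c' powr (q + 1)" using assms by (intro powr_mono2) auto
        then show ?thesis using True by (simp add: ennreal_leI)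
      qed simp
    qed
    also have "\<dots> = ennreal (c' powr (q + 1) * measure lebesgue (cube_set Q))"
      using A by (simp add: nn_integral_cmult_indicator sets_cube emeasure_cube_measure ennreal_mult
          del: emeasure_completion)
    finally show "pint (q + 1) (cube_set Q) g \<le> \<dots>" .
  qed simp
qed

text \<open>The inequality "average over 2P exceeds t" multiplied out. The double is tested because
  dilates of subcubes of P may leave P while remaining in 2P.\<close>

definition heavy :: "real \<Rightarrow> (real^'n::finite \<Rightarrow> complex) \<Rightarrow> real \<Rightarrow> 'n cube \<Rightarrow> bool" where
  "heavy p h t P \<longleftrightarrow>
    ennreal (t powr p * measure lebesgue (cube_set (dil 2 P))) < pint p (cube_set (dil 2 P)) h"

lemma heavy_antimono:
  assumes "heavy p h t P" "0 \<le> s" "s \<le> t" "0 \<le> p"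
  shows "heavy p h s P"
proof -
  have "s powr p * measure lebesgue (cube_set (dil 2 P)) \<le> t powr p * measure lebesgue (cube_set (dil 2 P))"
    using assms by (intro mult_right_mono powr_mono2) auto
  then show ?thesis using assms(1) unfolding heavy_def by (meson ennreal_leI le_less_trans)
qed

text \<open>Weighing the largest summand replaces both Minkowski's and Jensen's inequality.\<close>
lemma powr_sum3_bound:
  fixes p r L b g1 g2 h :: real
  assumes "1 \<le> p" "p \<le> r" "0 < L" "0 \<le> b" "0 \<le> g1" "0 \<le> g2" "0 \<le> h" "h \<le> b + g1 + g2"
  shows "h powr p \<le> L powr p * (1/2 + ((3 * b / L) powr p + (12 * g1 / L) powr r + (12 * g2 / L) powr r))"
proof -
  let ?W = "(3 * b / L) powr p + (12 * g1 / L) powr r + (12 * g2 / L) powr r"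
  \<comment> \<open>The factor 12 is 3 * 4: the 3 comes from the largest of three summands, and the
    4 makes the case u <= 1 contribute at most 1/4, below the constant 1/2. For u > 1 the exponent
    may be raised from p to r.\<close>
  have G: "(h / L) powr p \<le> 1/2 + (12 * g / L) powr r" if g: "0 \<le> g" "h \<le> 3 * g" for g
  proof -
    define u where "u = 12 * g / L"
    have u: "u \<ge> 0" using g assms by (simp add: u_def)
    have "h / L \<le> u / 4" using g assms by (simp add: u_def divide_right_mono)
    then have "(h / L) powr p \<le> (u / 4) powr p" using assms by (intro powr_mono2) auto
    also have "\<dots> \<le> 1/2 + u powr r"
    proof (cases "u \<le> 1")
      case True
      then have "(u / 4) powr p \<le> (1/4) powr p" using u assms by (intro powr_mono2) auto
      also have "\<dots> \<le> (1/4) powr 1" using assms by (intro powr_mono') auto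
      finally have "(u / 4) powr p \<le> 1/4" by simp
      then show ?thesis using powr_ge_zero[of u r] by linarith
    next
      case False
      then have "(u / 4) powr p \<le> u powr p" using u assms by (intro powr_mono2) auto
      also have "\<dots> \<le> u powr r" using False assms by (intro powr_mono) auto
      finally show ?thesis by simp
    qed
    finally show ?thesis by (simp add: u_def)
  qed
  have B: "(h / L) powr p \<le> (3 * b / L) powr p" if "h \<le> 3 * b"
    using that assms by (intro powr_mono2) (auto simp: divide_right_mono)
  have "h \<le> 3 * b \<or> h \<le> 3 * g1 \<or> h \<le> 3 * g2" using assms(8) by linarith
  then have "(h / L) powr p \<le> 1/2 + ?W"
    using G[of g1] G[of g2] B assms powr_ge_zero[of "3 * b / L" p] powr_ge_zero[of "12 * g1 / L" r]
      powr_ge_zero[of "12 * g2 / L" r] by (elim disjE) linarith+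
  then have "L powr p * (h / L) powr p \<le> L powr p * (1/2 + ?W)" by (intro mult_left_mono) auto
  then show ?thesis using assms by (simp add: powr_divide)
qed

section \<open>Heavy subcubes inside one cube\<close>

lemma pint_scaled:
  assumes "g \<in> borel_measurable lebesgue" "E \<in> sets lebesgue" "0 \<le> c"
  shows "(\<integral>\<^sup>+x\<in>E. ennreal ((c * cmod (g x)) powr p) \<partial>lebesgue) = ennreal (c powr p) * pint p E g"
proof -
  note [measurable] = assms(1,2)
  have "(\<integral>\<^sup>+x\<in>E. ennreal ((c * cmod (g x)) powr p) \<partial>lebesgue)
      = (\<integral>\<^sup>+x. ennreal (c powr p) * (ennreal (cmod (g x) powr p) * indicator E x) \<partial>lebesgue)"
    using assms(3) by (intro nn_integral_cong) (simp add: powr_mult ennreal_mult mult.assoc)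
  also have "\<dots> = ennreal (c powr p) * pint p E g"
    unfolding pint_def by (rule nn_integral_cmult) measurable
  finally show ?thesis .
qed

text \<open>A Chebyshev estimate with two exponents at once, doing the work of weak-type bounds for
  a maximal function. Heaviness forces |2P| <= 2 * (integral of W over 2P), and for disjoint doubles
  these integrals add up to at most that over 2R. The factor 6^n is 3^n from the covering times 2^n
  from |2R| = 2^n |R|; the 2 comes from absorbing half of |2P|.\<close>

lemma heavy_subcubes_measure_le:
  fixes R :: "'n::finite cube"
  assumes p: "1 \<le> p" "p \<le> r" and L: "0 < L" and R: "is_cube R"
    and meas: "h \<in> borel_measurable lebesgue" "b \<in> borel_measurable lebesgue"
      "g1 \<in> borel_measurable lebesgue" "g2 \<in> borel_measurable lebesgue"
    and split: "AE x in lebesgue. x \<in> cube_set (dil 2 R) \<longrightarrow> h x = b x + g1 x + g2 x"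
    and F: "finite F" "\<And>P. P \<in> F \<Longrightarrow> is_cube P" "\<And>P. P \<in> F \<Longrightarrow> cube_set P \<subseteq> cube_set R"
      "\<And>P. P \<in> F \<Longrightarrow> heavy p h L P"
    and bd: "pint p (cube_set (dil 2 R)) b \<le> ennreal (\<beta> powr p * measure lebesgue (cube_set (dil 2 R)))"
      "pint r (cube_set (dil 2 R)) g1 \<le> ennreal (G powr r * measure lebesgue (cube_set (dil 2 R)))"
      "pint r (cube_set (dil 2 R)) g2 \<le> ennreal (G powr r * measure lebesgue (cube_set (dil 2 R)))"
    and nonneg: "0 \<le> \<beta>" "0 \<le> G"
  shows "measure lebesgue (\<Union>P\<in>F. cube_set P)
    \<le> 6 ^ CARD('n) * 2 * ((3 * \<beta> / L) powr p + 2 * (12 * G / L) powr r) * measure lebesgue (cube_set R)"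
proof -
  note [measurable] = meas
  obtain H where H: "H \<subseteq> F" "disjoint_family_on (\<lambda>P. cube_set (dil 2 P)) H"
    "measure lebesgue (\<Union>P\<in>F. cube_set P)
      \<le> 3 ^ CARD('n) * (\<Sum>P\<in>H. measure lebesgue (cube_set (dil 2 P)))"
    using Vitali_measure[OF F(1,2)] by metis
  have finH: "finite H" using H(1) F(1) finite_subset by blast
  \<comment> \<open>The part of the pointwise bound of \<open>powr_sum3_bound\<close> beyond the
    constant 1/2.\<close>
  define W where "W x = ennreal ((3 / L * cmod (b x)) powr p)
      + ennreal ((12 / L * cmod (g1 x)) powr r) + ennreal ((12 / L * cmod (g2 x)) powr r)" for x
  have Wmeas [measurable]: "W \<in> borel_measurable lebesgue" unfolding W_def by measurable
  let ?V = "\<lambda>P. measure lebesgue (cube_set (dil 2 P))"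
  have cube: "is_cube (dil 2 P)" "cube_set (dil 2 P) \<subseteq> cube_set (dil 2 R)" if P: "P \<in> H" for P
  proof -
    have "P \<in> F" using P H(1) by blast
    then show "is_cube (dil 2 P)" "cube_set (dil 2 P) \<subseteq> cube_set (dil 2 R)"
      using F(2)[of P] F(3)[of P] cube_set_dil_mono[of P R 2] by simp_all
  qed
  have setR [measurable]: "cube_set (dil 2 R) \<in> sets lebesgue" by (rule sets_cube) (simp add: R)
  have one: "ennreal (?V P) \<le> 2 * (\<integral>\<^sup>+x\<in>cube_set (dil 2 P). W x \<partial>lebesgue)" if P: "P \<in> H" for P
  proof -
    let ?E = "cube_set (dil 2 P)"
    have E [measurable]: "?E \<in> sets lebesgue" using cube[OF P] sets_cube by blast
    have "ennreal (L powr p * ?V P) < pint p ?E h" using F(4)[of P] P H(1) unfolding heavy_def by blast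
    also have "\<dots> \<le> (\<integral>\<^sup>+x. ennreal (L powr p) * (ennreal (1/2) * indicator ?E x + W x * indicator ?E x) \<partial>lebesgue)"
      unfolding pint_def
    proof (rule nn_integral_mono_AE, use split in eventually_elim)
      case (elim x)
      show ?case
      proof (cases "x \<in> ?E")
        case True
        then have hx: "h x = b x + g1 x + g2 x" using elim cube(2)[OF P] by blast
        have "cmod (h x) powr p \<le> L powr p * (1/2 + ((3 * cmod (b x) / L) powr p
            + (12 * cmod (g1 x) / L) powr r + (12 * cmod (g2 x) / L) powr r))"
          by (rule powr_sum3_bound) (use p L hx norm_triangle_ineq in \<open>auto intro: norm_triangle_le add_mono\<close>)
        then have "ennreal (cmod (h x) powr p) \<le> ennreal (L powr p * (1/2 + ((3 * cmod (b x) / L) powr p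
            + (12 * cmod (g1 x) / L) powr r + (12 * cmod (g2 x) / L) powr r)))"
          by (rule ennreal_leI)
        also have "\<dots> = ennreal (L powr p) * (ennreal (1/2) + ennreal ((3 * cmod (b x) / L) powr p
            + (12 * cmod (g1 x) / L) powr r + (12 * cmod (g2 x) / L) powr r))"
          by (subst ennreal_plus[symmetric], simp, simp, rule ennreal_mult) simp_all
        also have "ennreal ((3 * cmod (b x) / L) powr p
            + (12 * cmod (g1 x) / L) powr r + (12 * cmod (g2 x) / L) powr r) = W x"
          by (simp add: W_def)
        finally show ?thesis using True by (simp only: indicator_simps mult_1_right)
      qed simp
    qed
    also have "\<dots> = ennreal (L powr p) * (ennreal (1/2 * ?V P) + (\<integral>\<^sup>+x\<in>?E. W x \<partial>lebesgue))"
    proof -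
      have half: "(\<integral>\<^sup>+x. ennreal (1/2) * indicator ?E x \<partial>lebesgue) = ennreal (1/2 * ?V P)"
        unfolding nn_integral_cmult_indicator[OF E] emeasure_cube_measure[OF cube(1)[OF P]]
        by (rule ennreal_mult[symmetric]) simp_all
      have add: "(\<integral>\<^sup>+x. ennreal (1/2) * indicator ?E x + W x * indicator ?E x \<partial>lebesgue)
          = (\<integral>\<^sup>+x. ennreal (1/2) * indicator ?E x \<partial>lebesgue) + (\<integral>\<^sup>+x\<in>?E. W x \<partial>lebesgue)"
        by (rule nn_integral_add) measurable
      show ?thesis unfolding half[symmetric] add[symmetric] by (rule nn_integral_cmult) measurable
    qed
    finally have less: "ennreal (L powr p * ?V P)
        < ennreal (L powr p) * (ennreal (1/2 * ?V P) + (\<integral>\<^sup>+x\<in>?E. W x \<partial>lebesgue))" .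
    show ?thesis
    proof (cases "\<integral>\<^sup>+x\<in>?E. W x \<partial>lebesgue")
      case (real w)
      have "ennreal (L powr p) * (ennreal (1/2 * ?V P) + ennreal w) = ennreal (L powr p * (1/2 * ?V P + w))"
        by (subst ennreal_plus[symmetric], simp, rule real, rule ennreal_mult[symmetric])
          (simp_all add: real)
      then have "L powr p * ?V P < L powr p * (1/2 * ?V P + w)"
        using less real by (simp only: ennreal_less_iff mult_nonneg_nonneg powr_ge_zero measure_nonneg)
      \<comment> \<open>The constant 1/2 in the pointwise bound is there for this absorption into
        the left side; an infinite integral of W makes the claim trivial.\<close>
      then have "?V P < 1/2 * ?V P + w" using L by (simp only: mult_less_cancel_left_pos powr_gt_zero)
      then have "?V P \<le> 2 * w" by linarith
      then have "ennreal (?V P) \<le> ennreal (2 * w)" by (rule ennreal_leI)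
      then show ?thesis using real by (simp add: ennreal_mult)
    qed (simp add: ennreal_mult_top)
  qed
  have "(\<integral>\<^sup>+x\<in>cube_set (dil 2 R). W x \<partial>lebesgue)
      = ennreal ((3 / L) powr p) * pint p (cube_set (dil 2 R)) b
        + ennreal ((12 / L) powr r) * pint r (cube_set (dil 2 R)) g1
        + ennreal ((12 / L) powr r) * pint r (cube_set (dil 2 R)) g2"
  proof -
    let ?E = "cube_set (dil 2 R)"
    let ?b = "\<lambda>x. ennreal ((3 / L * cmod (b x)) powr p) * indicator ?E x"
    let ?g = "\<lambda>g x. ennreal ((12 / L * cmod (g x)) powr r) * indicator ?E x"
    have "(\<integral>\<^sup>+x\<in>?E. W x \<partial>lebesgue) = (\<integral>\<^sup>+x. ?b x + ?g g1 x + ?g g2 x \<partial>lebesgue)"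
      by (simp only: W_def distrib_right)
    also have "\<dots> = (\<integral>\<^sup>+x. ?b x + ?g g1 x \<partial>lebesgue) + (\<integral>\<^sup>+x. ?g g2 x \<partial>lebesgue)"
      by (rule nn_integral_add) measurable
    also have "(\<integral>\<^sup>+x. ?b x + ?g g1 x \<partial>lebesgue) = (\<integral>\<^sup>+x. ?b x \<partial>lebesgue) + (\<integral>\<^sup>+x. ?g g1 x \<partial>lebesgue)"
      by (rule nn_integral_add) measurable
    finally show ?thesis using L pint_scaled[OF meas(2) setR, of "3 / L" p]
        pint_scaled[OF meas(3) setR, of "12 / L" r] pint_scaled[OF meas(4) setR, of "12 / L" r] by simp
  qed
  also have "\<dots> \<le> ennreal ((3 / L) powr p) * ennreal (\<beta> powr p * ?V R)
        + ennreal ((12 / L) powr r) * ennreal (G powr r * ?V R)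
        + ennreal ((12 / L) powr r) * ennreal (G powr r * ?V R)"
    using bd by (intro add_mono mult_left_mono) auto
  also have "\<dots> = ennreal (((3 * \<beta> / L) powr p + 2 * (12 * G / L) powr r) * ?V R)"
  proof -
    have scale: "ennreal ((c / L) powr s) * ennreal (d powr s * v) = ennreal ((c * d / L) powr s * v)"
      if "0 \<le> c" "0 \<le> d" "0 \<le> v" for c d s v
      using that L powr_mult[of "c / L" d s] by (simp add: ennreal_mult'[symmetric])
    show ?thesis unfolding scale[OF _ nonneg(1) measure_nonneg, of 3, simplified]
        scale[OF _ nonneg(2) measure_nonneg, of 12, simplified]
      by (simp add: ennreal_plus[symmetric] distrib_right del: ennreal_plus)
  qed
  finally have Wint: "(\<integral>\<^sup>+x\<in>cube_set (dil 2 R). W x \<partial>lebesgue) \<le> \<dots>" .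
  let ?S = "2 * ((3 * \<beta> / L) powr p + 2 * (12 * G / L) powr r) * ?V R"
  have "ennreal (\<Sum>P\<in>H. ?V P) = (\<Sum>P\<in>H. ennreal (?V P))" by (simp add: sum_ennreal)
  also have "\<dots> \<le> (\<Sum>P\<in>H. 2 * (\<integral>\<^sup>+x\<in>cube_set (dil 2 P). W x \<partial>lebesgue))"
    by (intro sum_mono one)
  also have "\<dots> = 2 * (\<integral>\<^sup>+x. (\<Sum>P\<in>H. W x * indicator (cube_set (dil 2 P)) x) \<partial>lebesgue)"
  proof -
    have "(\<integral>\<^sup>+x. (\<Sum>P\<in>H. W x * indicator (cube_set (dil 2 P)) x) \<partial>lebesgue)
        = (\<Sum>P\<in>H. \<integral>\<^sup>+x\<in>cube_set (dil 2 P). W x \<partial>lebesgue)"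
      by (rule nn_integral_sum)
        (intro borel_measurable_times_ennreal Wmeas borel_measurable_indicator sets_cube cube(1))
    then show ?thesis by (simp only: sum_distrib_left)
  qed
  also have "\<dots> \<le> 2 * (\<integral>\<^sup>+x\<in>cube_set (dil 2 R). W x \<partial>lebesgue)"
  proof (intro mult_left_mono nn_integral_mono)
    fix x
    have "(\<Sum>P\<in>H. W x * indicator (cube_set (dil 2 P)) x)
        = W x * indicator (\<Union>P\<in>H. cube_set (dil 2 P)) x"
      unfolding sum_distrib_left[symmetric] indicator_UN_disjoint[OF finH H(2)] ..
    also have "\<dots> \<le> W x * indicator (cube_set (dil 2 R)) x"
      using cube(2) by (auto simp: indicator_def)
    finally show "(\<Sum>P\<in>H. W x * indicator (cube_set (dil 2 P)) x) \<le> \<dots>" .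
  qed simp
  also have "\<dots> \<le> 2 * ennreal (((3 * \<beta> / L) powr p + 2 * (12 * G / L) powr r) * ?V R)"
    by (intro mult_left_mono Wint) simp
  also have "\<dots> = ennreal ?S"
    using ennreal_mult'[of 2 "((3 * \<beta> / L) powr p + 2 * (12 * G / L) powr r) * ?V R"]
    by (simp only: ennreal_numeral zero_le_numeral mult.assoc)
  finally have "ennreal (\<Sum>P\<in>H. ?V P) \<le> ennreal ?S" .
  then have "(\<Sum>P\<in>H. ?V P) \<le> ?S" by (simp add: ennreal_le_iff)
  then have "measure lebesgue (\<Union>P\<in>F. cube_set P) \<le> 3 ^ CARD('n) * ?S"
    using H(3) by (meson mult_left_mono order_trans zero_le_numeral zero_le_power)
  also have "\<dots> = 6 ^ CARD('n) * 2 * ((3 * \<beta> / L) powr p + 2 * (12 * G / L) powr r)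
      * measure lebesgue (cube_set R)"
    using R by (simp add: measure_cube power_mult_distrib)
      (simp add: mult.assoc[symmetric] power_mult_distrib[symmetric])
  finally show ?thesis .
qed


section \<open>Comparing the heavy sets at two levels\<close>

lemma lmeasurable_stopped:
  assumes "is_cube Q"
  shows "(\<Union>P\<in>stopping Q N bad. cube_set P) \<in> lmeasurable"
  using is_cube_stopping[OF assms]
  by (intro fmeasurable.finite_UN finite_stopping[OF assms] lmeasurable_cube) blast

lemma measure_stopped:
  assumes "is_cube Q"
  shows "measure lebesgue (\<Union>P\<in>stopping Q N bad. cube_set P)
    = (\<Sum>P\<in>stopping Q N bad. measure lebesgue (cube_set P))"
proof (rule measure_finite_Union[OF finite_stopping[OF assms] _ disjoint_stopping[OF assms]])
  show "cube_set ` stopping Q N bad \<subseteq> sets lebesgue"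
    using sets_cube is_cube_stopping[OF assms] by blast
  show "emeasure lebesgue (cube_set P) \<noteq> \<infinity>" if "P \<in> stopping Q N bad" for P
    unfolding emeasure_cube_measure[OF is_cube_stopping[OF assms that]] by simp
qed

lemma measure_stopped_le:
  assumes "is_cube Q"
  shows "measure lebesgue (\<Union>P\<in>stopping Q N bad. cube_set P) \<le> measure lebesgue (cube_set Q)"
proof (rule measure_mono_fmeasurable)
  show "(\<Union>P\<in>stopping Q N bad. cube_set P) \<subseteq> cube_set Q"
    using stopping_subset[OF assms] by blast
  show "(\<Union>P\<in>stopping Q N bad. cube_set P) \<in> sets lebesgue"
    using lmeasurable_stopped[OF assms] by (rule fmeasurableD)
qed (rule lmeasurable_cube[OF assms])

text \<open>The form of D_q that matches the covering selection: a finite sum indexed by cubes whose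
  doubles are disjoint. Injectivity of doubling turns the sum over the doubled family into a sum
  over P.\<close>

lemma in_Dq_finite:
  fixes a :: "'n::finite cube \<Rightarrow> real"
  assumes "in_Dq_with q C a" "is_cube Q" "finite H"
    "\<And>P. P \<in> H \<Longrightarrow> is_cube P \<and> cube_set (dil 2 P) \<subseteq> cube_set Q"
    "disjoint_family_on (\<lambda>P. cube_set (dil 2 P)) H"
  shows "(\<Sum>P\<in>H. a (dil 2 P) powr q * measure lebesgue (cube_set (dil 2 P)))
    \<le> C powr q * a Q powr q * measure lebesgue (cube_set Q)"
proof -
  have inj: "inj_on (dil 2) H"
    by (rule inj_onI) (auto simp: dil_def prod_eq_iff vec_eq_iff)
  have "disjoint_family_on cube_set (dil 2 ` H)"
    using assms(5) by (force simp: disjoint_family_on_def)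
  moreover have "\<forall>R\<in>dil 2 ` H. is_cube R \<and> cube_set R \<subseteq> cube_set Q"
    using assms(4) by fastforce
  ultimately have "(\<integral>\<^sup>+R. ennreal (a R powr q * measure lebesgue (cube_set R)) \<partial>count_space (dil 2 ` H))
          \<le> ennreal (C powr q * a Q powr q * measure lebesgue (cube_set Q))"
    using assms(1,2) unfolding in_Dq_with_def by blast
  then have "ennreal (\<Sum>P\<in>H. a (dil 2 P) powr q * measure lebesgue (cube_set (dil 2 P)))
      \<le> ennreal (C powr q * a Q powr q * measure lebesgue (cube_set Q))"
    using assms(3) by (simp add: nn_integral_count_space_finite sum.reindex[OF inj] sum_ennreal)
  then show ?thesis by simp
qed

text \<open>The combinatorial half of the argument, with the analysis inside one cube isolated in
  \<open>local_bound\<close>. In cubes with small a(2R) only the fraction \<open>\<theta>\<close>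
  survives at level K t; the other cubes are kept whole and charged to D_q.\<close>

lemma good_lambda:
  fixes Q :: "'n::finite cube"
  assumes Q: "is_cube Q" and pos: "0 < t" "1 \<le> K" "0 < \<gamma>" "0 \<le> p" "0 \<le> q" "0 \<le> \<theta>"
    and Dq: "in_Dq_with q Ca a" and a: "\<And>R. is_cube R \<Longrightarrow> 0 \<le> a R"
    and local_bound: "\<And>R F. R \<in> stopping Q N (heavy p h t) \<Longrightarrow> a (dil 2 R) \<le> \<gamma> * t \<Longrightarrow> finite F \<Longrightarrow>
      (\<And>P. P \<in> F \<Longrightarrow> is_cube P \<and> cube_set P \<subseteq> cube_set R \<and> heavy p h (K * t) P) \<Longrightarrow>
      measure lebesgue (\<Union>P\<in>F. cube_set P) \<le> \<theta> * measure lebesgue (cube_set R)"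
  shows "measure lebesgue (\<Union>P\<in>stopping Q N (heavy p h (K * t)). cube_set P)
    \<le> \<theta> * measure lebesgue (\<Union>P\<in>stopping Q N (heavy p h t). cube_set P)
      + 6 ^ CARD('n) * Ca powr q * (a (dil 2 Q) / (\<gamma> * t)) powr q * measure lebesgue (cube_set Q)"
proof -
  let ?S = "stopping Q N (heavy p h t)" and ?S' = "stopping Q N (heavy p h (K * t))"
  define Good where "Good = {R \<in> ?S. a (dil 2 R) \<le> \<gamma> * t}"
  define Bad where "Bad = ?S - Good"
  define F where "F R = {P \<in> ?S'. cube_set P \<subseteq> cube_set R}" for R
  have fin: "finite ?S" "finite ?S'" using finite_stopping[OF Q] by auto
  have finGB: "finite Good" "finite Bad" using fin by (auto simp: Good_def Bad_def)
  have finF: "finite (F R)" for R using fin by (simp add: F_def)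
  have cubeS: "is_cube R" "cube_set R \<subseteq> cube_set Q" if "R \<in> ?S" for R
    using is_cube_stopping[OF Q that] stopping_subset[OF Q that] by auto
  have F: "is_cube P \<and> cube_set P \<subseteq> cube_set R \<and> heavy p h (K * t) P" if "P \<in> F R" for P R
  proof -
    have P: "P \<in> ?S'" "cube_set P \<subseteq> cube_set R" using that by (simp_all add: F_def)
    then show ?thesis using is_cube_stopping[OF Q P(1)] by (blast elim: stoppingE)
  qed
  have setF: "(\<Union>P\<in>F R. cube_set P) \<in> sets lebesgue" for R
    using F by (intro sets.finite_UN finF sets_cube) blast
  have setB: "(\<Union>R\<in>Bad. cube_set R) \<in> sets lebesgue"
    using cubeS by (intro sets.finite_UN finGB sets_cube) (auto simp: Bad_def)
  have setG: "(\<Union>R\<in>Good. \<Union>P\<in>F R. cube_set P) \<in> sets lebesgue"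
    by (intro sets.finite_UN finGB setF)
  have cover: "(\<Union>P\<in>?S'. cube_set P) \<subseteq> (\<Union>R\<in>Good. \<Union>P\<in>F R. cube_set P) \<union> (\<Union>R\<in>Bad. cube_set R)"
  proof (rule UN_least)
    fix P assume P: "P \<in> ?S'"
    then obtain m x where x: "P = dyad Q m x" "x \<in> cube_set Q" "m \<le> N" "heavy p h (K * t) (dyad Q m x)"
      by (auto elim: stoppingE)
    \<comment> \<open>Since K >= 1, a cube heavy at level K t is heavy at level t, so its branch has
      already met a maximal heavy cube of level t by generation m.\<close>
    have "heavy p h t (dyad Q m x)"
      using heavy_antimono[OF x(4), of t] pos by simp
    then obtain R where "R \<in> ?S" "cube_set P \<subseteq> cube_set R"
      using exists_stopping[OF Q x(2,3)] x(1) by metis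
    then show "cube_set P \<subseteq> (\<Union>R\<in>Good. \<Union>P\<in>F R. cube_set P) \<union> (\<Union>R\<in>Bad. cube_set R)"
      using P by (auto simp: F_def Bad_def)
  qed
  have "measure lebesgue (\<Union>P\<in>?S'. cube_set P)
      \<le> measure lebesgue ((\<Union>R\<in>Good. \<Union>P\<in>F R. cube_set P) \<union> (\<Union>R\<in>Bad. cube_set R))"
  proof (rule measure_mono_fmeasurable[OF cover])
    show "(\<Union>P\<in>?S'. cube_set P) \<in> sets lebesgue" using lmeasurable_stopped[OF Q] by auto
    have "(\<Union>R\<in>Good. \<Union>P\<in>F R. cube_set P) \<union> (\<Union>R\<in>Bad. cube_set R) \<subseteq> cube_set Q"
      using cubeS(2) stopping_subset[OF Q] unfolding Good_def Bad_def F_def by blast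
    then show "(\<Union>R\<in>Good. \<Union>P\<in>F R. cube_set P) \<union> (\<Union>R\<in>Bad. cube_set R) \<in> lmeasurable"
      by (rule fmeasurableI2[OF lmeasurable_cube[OF Q] _ sets.Un[OF setG setB]])
  qed
  also have "\<dots> \<le> measure lebesgue (\<Union>R\<in>Good. \<Union>P\<in>F R. cube_set P) + measure lebesgue (\<Union>R\<in>Bad. cube_set R)"
    by (rule measure_Un_le[OF setG setB])
  also have "\<dots> \<le> \<theta> * measure lebesgue (\<Union>P\<in>?S. cube_set P)
      + 6 ^ CARD('n) * Ca powr q * (a (dil 2 Q) / (\<gamma> * t)) powr q * measure lebesgue (cube_set Q)"
  proof (rule add_mono)
    have "measure lebesgue (\<Union>R\<in>Good. \<Union>P\<in>F R. cube_set P)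
        \<le> (\<Sum>R\<in>Good. measure lebesgue (\<Union>P\<in>F R. cube_set P))"
      by (rule measure_UNION_le[OF finGB(1) setF])
    also have "\<dots> \<le> (\<Sum>R\<in>Good. \<theta> * measure lebesgue (cube_set R))"
    proof (rule sum_mono)
      fix R assume "R \<in> Good"
      then have "R \<in> ?S" "a (dil 2 R) \<le> \<gamma> * t" by (simp_all add: Good_def)
      then show "measure lebesgue (\<Union>P\<in>F R. cube_set P) \<le> \<theta> * measure lebesgue (cube_set R)"
        by (rule local_bound[OF _ _ finF F])
    qed
    also have "\<dots> \<le> (\<Sum>R\<in>?S. \<theta> * measure lebesgue (cube_set R))"
      using pos by (intro sum_mono2 fin) (auto simp: Good_def)
    also have "\<dots> = \<theta> * measure lebesgue (\<Union>P\<in>?S. cube_set P)"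
      by (simp add: measure_stopped[OF Q] sum_distrib_left)
    finally show "measure lebesgue (\<Union>R\<in>Good. \<Union>P\<in>F R. cube_set P) \<le> \<dots>" .
  next
    have cubeB: "is_cube R" if "R \<in> Bad" for R using that cubeS by (simp add: Bad_def)
    obtain H where H: "H \<subseteq> Bad" "disjoint_family_on (\<lambda>P. cube_set (dil 2 P)) H"
      "measure lebesgue (\<Union>P\<in>Bad. cube_set P)
        \<le> 3 ^ CARD('n) * (\<Sum>P\<in>H. measure lebesgue (cube_set (dil 2 P)))"
      using Vitali_measure[OF finGB(2) cubeB] by metis
    let ?M = "\<lambda>P. measure lebesgue (cube_set (dil 2 P))"
    have HS: "is_cube P" "cube_set P \<subseteq> cube_set Q" "\<gamma> * t < a (dil 2 P)" if P: "P \<in> H" for P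
    proof -
      have "P \<in> ?S" "P \<notin> Good" using P H(1) by (auto simp: Bad_def)
      then show "is_cube P" "cube_set P \<subseteq> cube_set Q" "\<gamma> * t < a (dil 2 P)"
        using cubeS[of P] by (auto simp: Good_def)
    qed
    have gt: "0 < \<gamma> * t" using pos by simp
    \<comment> \<open>Chebyshev for the functional: on these cubes a(2P) / (gamma t) exceeds 1, so
      its q-th power may be inserted.\<close>
    have "(\<Sum>P\<in>H. ?M P) \<le> (\<Sum>P\<in>H. (1 / (\<gamma> * t)) powr q * (a (dil 2 P) powr q * ?M P))"
    proof (rule sum_mono)
      fix P assume P: "P \<in> H"
      have "1 \<le> a (dil 2 P) / (\<gamma> * t)" using HS(3)[OF P] gt by simp
      then have "1 \<le> (a (dil 2 P) / (\<gamma> * t)) powr q" using pos by (intro ge_one_powr_ge_zero)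
      then have "1 * ?M P \<le> (a (dil 2 P) / (\<gamma> * t)) powr q * ?M P"
        by (intro mult_right_mono) auto
      then show "?M P \<le> (1 / (\<gamma> * t)) powr q * (a (dil 2 P) powr q * ?M P)"
        using gt HS(3)[OF P] by (simp add: powr_divide)
    qed
    also have "\<dots> = (1 / (\<gamma> * t)) powr q * (\<Sum>P\<in>H. a (dil 2 P) powr q * ?M P)"
      by (simp add: sum_distrib_left)
    \<comment> \<open>The doubles need not lie in Q but do lie in 2Q, so D_q is applied there. Hence
      the term a(2Q), the one with weight eta_1 = 1, and the factor 2^n that makes 6^n out of the
      covering constant 3^n.\<close>
    also have "\<dots> \<le> (1 / (\<gamma> * t)) powr q * (Ca powr q * a (dil 2 Q) powr q * ?M Q)"
    proof (intro mult_left_mono in_Dq_finite[OF Dq])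
      show "is_cube P \<and> cube_set (dil 2 P) \<subseteq> cube_set (dil 2 Q)" if "P \<in> H" for P
        using HS(1,2)[OF that] cube_set_dil_mono[of P Q 2] by simp
      show "finite H" using H(1) finGB(2) by (rule finite_subset)
    qed (simp_all add: Q H(2))
    also have "\<dots> = 2 ^ CARD('n) * (Ca powr q * (a (dil 2 Q) / (\<gamma> * t)) powr q * measure lebesgue (cube_set Q))"
      using Q gt a[of "dil 2 Q"] by (simp add: measure_cube powr_divide power_mult_distrib)
    finally have "3 ^ CARD('n) * (\<Sum>P\<in>H. ?M P) \<le> 3 ^ CARD('n) * (2 ^ CARD('n)
        * (Ca powr q * (a (dil 2 Q) / (\<gamma> * t)) powr q * measure lebesgue (cube_set Q)))"
      by (intro mult_left_mono) auto
    also have "\<dots> = (3 * 2) ^ CARD('n) * (Ca powr q * (a (dil 2 Q) / (\<gamma> * t)) powr q * measure lebesgue (cube_set Q))"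
      by (simp only: power_mult_distrib mult.assoc)
    finally show "measure lebesgue (\<Union>R\<in>Bad. cube_set R) \<le> 6 ^ CARD('n) * Ca powr q
        * (a (dil 2 Q) / (\<gamma> * t)) powr q * measure lebesgue (cube_set Q)"
      using H(3) by (simp add: mult.assoc)
  qed
  finally show ?thesis .
qed

text \<open>For k <= m the dilate fits into the double of the ancestor k generations up, which is
  light. For k > m that ancestor would be larger than Q, and the assumed average over 2^k Q takes
  its place. Stating the sum of both bounds frees later summations over k from the case
  distinction.\<close>

lemma avgp_dilated_stopping_le:
  fixes Q :: "'n::finite cube"
  assumes Q: "is_cube Q" and x: "x \<in> cube_set Q" and p: "1 \<le> p" and t: "0 \<le> t" and k: "1 \<le> k"
    and light: "\<And>m'. m' < m \<Longrightarrow> \<not> heavy p h t (dyad Q m' x)"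
    and avgQ: "avgp p (cube_set (dil (2 ^ k) Q)) h \<le> ennreal c" and c: "0 \<le> c"
  shows "avgp p (cube_set (dil (2 ^ k) (dyad Q m x))) h
    \<le> ennreal (2 ^ CARD('n) * t + 2 powr (real k * real CARD('n) / p) * c)"
proof -
  let ?n = "CARD('n)" and ?R = "dyad Q m x"
  let ?V = "measure lebesgue (cube_set (dil (2 ^ k) ?R))"
  let ?A = "2 ^ ?n * t" and ?B = "2 powr (real k * real ?n / p) * c"
  have R: "is_cube ?R" "cube_set ?R \<subseteq> cube_set Q" using Q dyad_subset[OF Q x] by auto
  have nonneg: "0 \<le> ?A" "0 \<le> ?B" using t c by auto
  have "pint p (cube_set (dil (2 ^ k) ?R)) h \<le> ennreal ((?A + ?B) powr p * ?V)"
  proof (cases "k \<le> m")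
    case True
    \<comment> \<open>Because k >= 1, this ancestor is strictly coarser than the cube itself, so the
      lightness hypothesis covers it.\<close>
    let ?T = "dyad Q (m - k) x"
    have pw: "(2::real) ^ m = 2 ^ k * 2 ^ (m - k)" using True by (simp flip: power_add)
    have side: "snd ?T = 2 ^ k * snd ?R" unfolding snd_dyad pw by simp
    have "pint p (cube_set (dil (2 ^ k) ?R)) h \<le> pint p (cube_set (dil 2 ?T)) h"
      by (rule pint_mono, rule cube_set_dil_ancestor[OF R(1) dyad_mono[OF Q] side]) auto
    also have "\<dots> \<le> ennreal (t powr p * measure lebesgue (cube_set (dil 2 ?T)))"
      using light[of "m - k"] True k by (simp add: heavy_def not_less)
    also have "\<dots> \<le> ennreal ((?A + ?B) powr p * ?V)"
    proof (rule ennreal_leI)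
      have "measure lebesgue (cube_set (dil 2 ?T)) = 2 ^ ?n * ?V"
        using Q side by (simp add: measure_cube power_mult_distrib del: snd_dyad)
      then have "t powr p * measure lebesgue (cube_set (dil 2 ?T)) = (2 ^ ?n * t powr p) * ?V" by simp
      \<comment> \<open>The volume ratio 2^n would cost only 2^(n/p) after taking roots; the cruder
        2^n keeps the constant free of p.\<close>
      also have "\<dots> \<le> ((2 ^ ?n) powr p * t powr p) * ?V"
      proof (intro mult_right_mono)
        show "(2::real) ^ ?n \<le> (2 ^ ?n) powr p"
          using powr_mono[OF p, of "2 ^ ?n"] by simp
      qed auto
      also have "\<dots> = ?A powr p * ?V" using t by (simp add: powr_mult)
      also have "\<dots> \<le> (?A + ?B) powr p * ?V"
        using nonneg p by (intro mult_right_mono powr_mono2) auto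
      finally show "t powr p * measure lebesgue (cube_set (dil 2 ?T)) \<le> (?A + ?B) powr p * ?V" .
    qed
    finally show ?thesis .
  next
    case False
    have "pint p (cube_set (dil (2 ^ k) ?R)) h \<le> pint p (cube_set (dil (2 ^ k) Q)) h"
      by (rule pint_mono, rule cube_set_dil_mono[OF R]) simp
    also have "\<dots> \<le> ennreal (c powr p * measure lebesgue (cube_set (dil (2 ^ k) Q)))"
      using avgQ avgp_le_iff[of "dil (2 ^ k) Q" p c h] Q p c by simp
    also have "\<dots> \<le> ennreal ((?A + ?B) powr p * ?V)"
    proof (rule ennreal_leI)
      \<comment> \<open>The volume ratio is 2^(mn), bounded by 2^(kn) since m < k; its p-th root is
        the weight 2^(kn/p).\<close>
      have "snd Q = 2 ^ m * snd ?R" by simp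
      then have "measure lebesgue (cube_set (dil (2 ^ k) Q)) = (2 ^ m) ^ ?n * ?V"
        using Q by (simp add: measure_cube power_mult_distrib[symmetric] mult.left_commute del: snd_dyad)
      also have "\<dots> \<le> (2 ^ k) ^ ?n * ?V"
        using False by (intro mult_right_mono power_mono power_increasing) auto
      finally have "c powr p * measure lebesgue (cube_set (dil (2 ^ k) Q)) \<le> c powr p * ((2 ^ k) ^ ?n * ?V)"
        by (intro mult_left_mono) auto
      also have "\<dots> = ?B powr p * ?V"
      proof -
        have "((2::real) ^ k) ^ ?n = 2 powr (real k * real ?n)"
          by (simp add: powr_realpow[symmetric] powr_powr)
        then show ?thesis using p c by (simp add: powr_mult powr_powr)
      qed
      also have "\<dots> \<le> (?A + ?B) powr p * ?V"
        using nonneg p by (intro mult_right_mono powr_mono2) auto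
      finally show "c powr p * measure lebesgue (cube_set (dil (2 ^ k) Q)) \<le> (?A + ?B) powr p * ?V" .
    qed
    finally show ?thesis .
  qed
  then show ?thesis using avgp_le_iff[of "dil (2 ^ k) ?R" p "?A + ?B" h] R p nonneg by simp
qed

text \<open>Let T be a compact part of the exceptional set E. A dyadic P meeting T is light, so
  |h|^p >= 2^(n+1) t^p on T leaves T at most half of P. Taking all such P inside an open U with |U|
  <= |T| + e gives 2|T| <= |U| <= |T| + e. In 2^(n+1), 2^n is the volume ratio of 2P to P and the
  remaining 2 produces the half.\<close>

lemma AE_le_off_heavy:
  fixes Q :: "'n::finite cube"
  assumes Q: "is_cube Q" and p: "1 \<le> p" and t: "0 < t" and h: "h \<in> borel_measurable lebesgue"
  shows "AE x in lebesgue. x \<in> cube_set Q \<and> (\<forall>m. \<not> heavy p h t (dyad Q m x)) \<longrightarrow>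
    cmod (h x) \<le> 2 ^ (CARD('n) + 1) * t"
proof -
  note [measurable] = h
  let ?c = "2 ^ (CARD('n) + 1) :: real"
  define E where "E = {x \<in> cube_set Q. ?c * t < cmod (h x)}
      - (\<Union>N. \<Union>P\<in>stopping Q N (heavy p h t). cube_set P)"
  have Eset: "E \<in> sets lebesgue"
  proof -
    have "{x \<in> space lebesgue. ?c * t < cmod (h x)} \<in> sets lebesgue" by measurable
    then have "cube_set Q \<inter> {x. ?c * t < cmod (h x)} \<in> sets lebesgue"
      using sets_cube[OF Q] by auto
    then show ?thesis unfolding E_def Collect_conj_eq Collect_mem_eq
      using lmeasurable_stopped[OF Q] by (intro sets.Diff sets.countable_UN) auto
  qed
  have light: "\<not> heavy p h t (dyad Q m x)" if x: "x \<in> E" for m x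
  proof
    assume "heavy p h t (dyad Q m x)"
    then obtain R where "R \<in> stopping Q m (heavy p h t)" "cube_set (dyad Q m x) \<subseteq> cube_set R"
      using exists_stopping[OF Q, of x m m] x by (auto simp: E_def)
    then show False using x mem_dyad[OF Q, of x m] unfolding E_def by blast
  qed
  have cE: "(2 * 2 ^ CARD('n)) * t powr p \<le> cmod (h x) powr p" if x: "x \<in> E" for x
  proof -
    have "?c * t powr p \<le> ?c powr p * t powr p"
    proof (intro mult_right_mono)
      have "1 \<le> ?c" by (rule one_le_power) simp
      then show "?c \<le> ?c powr p" using powr_mono[OF p, of ?c] by simp
    qed simp
    also have "\<dots> = (?c * t) powr p" using t by (simp add: powr_mult)
    also have "\<dots> \<le> cmod (h x) powr p" using x t p by (intro powr_mono2) (auto simp: E_def)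
    finally show ?thesis by simp
  qed
  have null: "measure lebesgue T \<le> e" if T: "compact T" "T \<subseteq> E" and e: "0 < e" for T e
  proof -
    have Tm: "T \<in> lmeasurable" using T(1) by (rule lmeasurable_compact)
    obtain U where U: "open U" "T \<subseteq> U" "U - T \<in> lmeasurable" "emeasure lebesgue (U - T) < ennreal e"
      using sets_lebesgue_outer_open[OF fmeasurableD[OF Tm] e] by metis
    have Um: "U \<in> lmeasurable" "measure lebesgue U \<le> measure lebesgue T + e"
    proof -
      have U_eq: "U = T \<union> (U - T)" using U(2) by blast
      show "U \<in> lmeasurable" by (subst U_eq) (intro fmeasurable.Un Tm U(3))
      have "measure lebesgue (U - T) \<le> e"
        using U(4) e by (simp add: emeasure_eq_measure2[OF U(3)] ennreal_less_iff del: emeasure_completion)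
      then show "measure lebesgue U \<le> measure lebesgue T + e"
        using measure_Un_le[of T lebesgue "U - T"] Tm U(3) U_eq by fastforce
    qed
    obtain \<delta> where \<delta>: "0 < \<delta>" "(\<Union>x\<in>T. ball x \<delta>) \<subseteq> U"
      using compact_subset_open_imp_ball_epsilon_subset[OF T(1) U(1,2)] by metis
    \<comment> \<open>So fine that each generation-N cube lies within distance delta of any of its
      points, the diameter being bounded by the l1 norm.\<close>
    obtain N where N: "real CARD('n) * snd Q / \<delta> < 2 ^ N"
      using real_arch_pow[of 2] by auto
    let ?D = "dyad Q N ` T"
    have TQ: "T \<subseteq> cube_set Q" using T(2) by (auto simp: E_def)
    have fin: "finite ?D" using finite_dyads[OF Q, of N] TQ by (meson finite_subset image_mono)
    have cube: "is_cube P" if "P \<in> ?D" for P using that Q by auto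
    have disj: "disjoint_family_on cube_set ?D"
    proof -
      have "dyad Q N x = dyad Q N y" if "z \<in> cube_set (dyad Q N x)" "z \<in> cube_set (dyad Q N y)" for x y z
        using that[THEN dyad_coarser_eq[OF Q _ order.refl]] by simp
      then show ?thesis unfolding disjoint_family_on_def by blast
    qed
    have sub: "cube_set P \<subseteq> U" if P: "P \<in> ?D" for P
    proof
      fix y assume y: "y \<in> cube_set P"
      obtain x where x: "x \<in> T" "P = dyad Q N x" using P by auto
      have "\<bar>(y - x) $ i\<bar> \<le> snd Q / 2 ^ N" for i
        using y mem_dyad[OF Q, of x N] unfolding x(2) cube_set_def
        by (auto dest!: spec[of _ i])
      then have "(\<Sum>i\<in>UNIV. \<bar>(y - x) $ i\<bar>) \<le> (\<Sum>i\<in>(UNIV::'n set). snd Q / 2 ^ N)"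
        by (rule sum_mono)
      then have "norm (y - x) \<le> real CARD('n) * snd Q / 2 ^ N"
        using norm_le_l1_cart[of "y - x"] by simp
      also have "\<dots> < \<delta>" using N \<delta>(1) by (simp add: field_simps)
      finally have "y \<in> ball x \<delta>" by (simp add: dist_norm norm_minus_commute)
      then show "y \<in> U" using \<delta>(2) x(1) by blast
    qed
    have half: "2 * measure lebesgue (cube_set P \<inter> T) \<le> measure lebesgue (cube_set P)"
      if P: "P \<in> ?D" for P
    proof -
      obtain x where x: "x \<in> T" "P = dyad Q N x" using P by auto
      have PT: "cube_set P \<inter> T \<in> lmeasurable"
        by (intro fmeasurable.Int lmeasurable_cube cube P Tm)
      let ?d = "(2 * 2 ^ CARD('n)) * t powr p"
      have "ennreal (?d * measure lebesgue (cube_set P \<inter> T))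
          = (\<integral>\<^sup>+x. ennreal ?d * indicator (cube_set P \<inter> T) x \<partial>lebesgue)"
        using PT by (simp add: nn_integral_cmult_indicator fmeasurableD emeasure_eq_measure2 ennreal_mult'
            del: emeasure_completion)
      also have "\<dots> \<le> pint p (cube_set (dil 2 P)) h"
        unfolding pint_def
      proof (rule nn_integral_mono)
        fix y
        show "ennreal ?d * indicator (cube_set P \<inter> T) y
            \<le> ennreal (cmod (h y) powr p) * indicator (cube_set (dil 2 P)) y"
          using cE[of y] T(2) cube_subset_dil[OF cube[OF P], of 2]
          by (auto simp: indicator_def intro!: ennreal_leI)
      qed
      also have "\<dots> \<le> ennreal (t powr p * measure lebesgue (cube_set (dil 2 P)))"
        using light[of x N] x T(2) by (auto simp: heavy_def not_less)
      finally have "?d * measure lebesgue (cube_set P \<inter> T) \<le> t powr p * measure lebesgue (cube_set (dil 2 P))"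
        by (subst (asm) ennreal_le_iff) auto
      also have "\<dots> = t powr p * (2 ^ CARD('n) * measure lebesgue (cube_set P))"
        using cube[OF P] by (simp add: measure_cube power_mult_distrib)
      finally have "(t powr p * 2 ^ CARD('n)) * (2 * measure lebesgue (cube_set P \<inter> T))
          \<le> (t powr p * 2 ^ CARD('n)) * measure lebesgue (cube_set P)" by (simp add: mult_ac)
      then show ?thesis by (rule mult_left_le_imp_le) (use t in simp)
    qed
    have "T \<subseteq> (\<Union>P\<in>?D. cube_set P \<inter> T)" using mem_dyad[OF Q] by blast
    then have "measure lebesgue T \<le> measure lebesgue (\<Union>P\<in>?D. cube_set P \<inter> T)"
      using Tm by (intro measure_mono_fmeasurable fmeasurable.finite_UN fin fmeasurable.Int lmeasurable_cube cube) auto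
    also have "\<dots> \<le> (\<Sum>P\<in>?D. measure lebesgue (cube_set P \<inter> T))"
      using Tm cube by (intro measure_UNION_le fin sets.Int sets_cube) auto
    finally have "2 * measure lebesgue T \<le> (\<Sum>P\<in>?D. 2 * measure lebesgue (cube_set P \<inter> T))"
      by (simp add: sum_distrib_left[symmetric])
    also have "\<dots> \<le> (\<Sum>P\<in>?D. measure lebesgue (cube_set P))" by (intro sum_mono half)
    also have "\<dots> = measure lebesgue (\<Union>P\<in>?D. cube_set P)"
    proof (rule measure_finite_Union[OF fin _ disj, symmetric])
      show "cube_set ` ?D \<subseteq> sets lebesgue" using sets_cube cube by blast
      show "emeasure lebesgue (cube_set P) \<noteq> \<infinity>" if "P \<in> ?D" for P
        unfolding emeasure_cube_measure[OF cube[OF that]] by simp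
    qed
    also have "\<dots> \<le> measure lebesgue U"
    proof (rule measure_mono_fmeasurable[OF _ _ Um(1)])
      show "(\<Union>P\<in>?D. cube_set P) \<subseteq> U" using sub by blast
      show "(\<Union>P\<in>?D. cube_set P) \<in> sets lebesgue" by (intro sets.finite_UN fin sets_cube cube)
    qed
    finally show "measure lebesgue T \<le> e" using Um(2) by linarith
  qed
  \<comment> \<open>Inner regularity: E is exhausted up to measure e by closed subsets, which are
    compact because Q is bounded.\<close>
  have "emeasure lebesgue E \<le> 0"
  proof (rule ennreal_le_epsilon)
    fix e :: real assume e: "0 < e"
    obtain T where T: "closed T" "T \<subseteq> E" "E - T \<in> lmeasurable" "emeasure lebesgue (E - T) < ennreal e"
      using sets_lebesgue_inner_closed[OF Eset e] by metis
    have "bounded (cube_set Q)" using cube_set_box(2)[of Q] bounded_cbox bounded_subset by blast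
    then have cT: "compact T" using T by (auto simp: compact_eq_bounded_closed E_def intro: bounded_subset)
    have "measure lebesgue T \<le> 0"
      by (rule field_le_epsilon) (simp add: null[OF cT T(2)])
    then have "measure lebesgue T = 0" using measure_nonneg[of lebesgue T] by linarith
    then have "emeasure lebesgue T = 0"
      using emeasure_eq_measure2[OF lmeasurable_compact[OF cT]] by simp
    moreover have "emeasure lebesgue E \<le> emeasure lebesgue T + emeasure lebesgue (E - T)"
    proof -
      have "E = T \<union> (E - T)" using T(2) by blast
      then show ?thesis
        using emeasure_subadditive[of T lebesgue "E - T"] T(3) lmeasurable_compact[OF cT] by auto
    qed
    ultimately show "emeasure lebesgue E \<le> 0 + ennreal e" using T(4) by simp
  qed
  then have "E \<in> null_sets lebesgue" using Eset by (auto simp: null_sets_def)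
  then have "AE x in lebesgue. x \<notin> E" by (rule AE_not_in)
  then show ?thesis
  proof eventually_elim
    case (elim x)
    have "\<not> ?c * t < cmod (h x)" if x: "x \<in> cube_set Q" "\<And>m. \<not> heavy p h t (dyad Q m x)"
    proof
      assume "?c * t < cmod (h x)"
      then obtain N R where R: "R \<in> stopping Q N (heavy p h t)" "x \<in> cube_set R"
        using elim x(1) unfolding E_def by blast
      obtain m y where "R = dyad Q m y" "heavy p h t (dyad Q m y)" using R(1) by (blast elim: stoppingE)
      then show False using x(2)[of m] R(2) dyad_coarser_eq[OF Q, of x m y m] by simp
    qed
    then show ?case by (meson not_less)
  qed
qed


subsection \<open>Splitting on a stopping cube\<close>

lemma locLp_indicator:
  assumes "locLp p f" "E \<in> sets lebesgue"
  shows "locLp p (\<lambda>x. indicator E x * f x)"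
proof -
  have "(\<integral>\<^sup>+x\<in>K. ennreal (cmod (indicator E x * f x) powr p) \<partial>lebesgue)
      \<le> (\<integral>\<^sup>+x\<in>K. ennreal (cmod (f x) powr p) \<partial>lebesgue)" for K
    by (intro nn_integral_mono) (auto simp: indicator_def)
  moreover have "(\<lambda>x. indicator E x * f x) \<in> borel_measurable lebesgue"
    using assms by (intro borel_measurable_times borel_measurable_indicator) (auto simp: locLp_def)
  ultimately show ?thesis using assms(1) unfolding locLp_def by (meson le_less_trans)
qed

lemma locLp_cmult:
  assumes "locLp p f" shows "locLp p (\<lambda>x. c * f x)"
proof -
  have [measurable]: "f \<in> borel_measurable lebesgue" using assms by (simp add: locLp_def)
  have "(\<integral>\<^sup>+x\<in>K. ennreal (cmod (c * f x) powr p) \<partial>lebesgue) < top" if "compact K" for K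
  proof -
    have K: "K \<in> sets lebesgue" using lmeasurable_compact[OF that] by (rule fmeasurableD)
    have "(\<integral>\<^sup>+x\<in>K. ennreal (cmod (c * f x) powr p) \<partial>lebesgue) = ennreal (cmod c powr p) * pint p K f"
      using pint_scaled[OF _ K, of f "cmod c" p] by (simp add: norm_mult)
    also have "\<dots> < top" using assms that by (auto simp: locLp_def pint_def ennreal_mult_less_top)
    finally show ?thesis .
  qed
  moreover have "(\<lambda>x. c * f x) \<in> borel_measurable lebesgue" by measurable
  ultimately show ?thesis unfolding locLp_def by blast
qed

lemma locLp_add:
  assumes "locLp p f" "locLp p g" "0 \<le> p"
  shows "locLp p (\<lambda>x. f x + g x)"
proof -
  have [measurable]: "f \<in> borel_measurable lebesgue" "g \<in> borel_measurable lebesgue"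
    using assms by (simp_all add: locLp_def)
  have bound: "cmod (u + v) powr p \<le> 2 powr p * (cmod u powr p + cmod v powr p)" for u v
  proof -
    have "cmod (u + v) \<le> 2 * max (cmod u) (cmod v)" using norm_triangle_ineq[of u v] by linarith
    then have "cmod (u + v) powr p \<le> (2 * max (cmod u) (cmod v)) powr p"
      using assms(3) by (intro powr_mono2) auto
    also have "\<dots> = 2 powr p * max (cmod u) (cmod v) powr p"
      by (rule powr_mult)
    also have "\<dots> \<le> 2 powr p * (cmod u powr p + cmod v powr p)"
      by (intro mult_left_mono) (auto simp: max_def)
    finally show ?thesis .
  qed
  have "(\<integral>\<^sup>+x\<in>K. ennreal (cmod (f x + g x) powr p) \<partial>lebesgue) < top" if "compact K" for K
  proof -
    have K [measurable]: "K \<in> sets lebesgue" using lmeasurable_compact[OF that] by (rule fmeasurableD)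
    let ?F = "\<lambda>f x. ennreal (cmod (f x) powr p) * indicator K x"
    have "(\<integral>\<^sup>+x\<in>K. ennreal (cmod (f x + g x) powr p) \<partial>lebesgue)
        \<le> (\<integral>\<^sup>+x. ennreal (2 powr p) * (?F f x + ?F g x) \<partial>lebesgue)"
    proof (rule nn_integral_mono)
      fix x
      have "ennreal (cmod (f x + g x) powr p) \<le> ennreal (2 powr p) * (ennreal (cmod (f x) powr p) + ennreal (cmod (g x) powr p))"
        using ennreal_leI[OF bound[of "f x" "g x"]] by (simp add: ennreal_mult')
      then show "ennreal (cmod (f x + g x) powr p) * indicator K x \<le> ennreal (2 powr p) * (?F f x + ?F g x)"
        by (auto simp: indicator_def)
    qed
    also have "\<dots> = ennreal (2 powr p) * (\<integral>\<^sup>+x. ?F f x + ?F g x \<partial>lebesgue)"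
      by (rule nn_integral_cmult) measurable
    also have "(\<integral>\<^sup>+x. ?F f x + ?F g x \<partial>lebesgue) = (\<integral>\<^sup>+x. ?F f x \<partial>lebesgue) + (\<integral>\<^sup>+x. ?F g x \<partial>lebesgue)"
      by (rule nn_integral_add) measurable
    finally show ?thesis
      using assms that by (auto simp: locLp_def ennreal_mult_less_top intro: le_less_trans)
  qed
  moreover have "(\<lambda>x. f x + g x) \<in> borel_measurable lebesgue" by measurable
  ultimately show ?thesis unfolding locLp_def by blast
qed

lemma locLp_Aop:
  assumes "lin_family p B" "is_cube Q" "locLp p f" "0 \<le> p"
  shows "locLp p (Aop B Q f)"
proof -
  have "locLp p (B Q f)" using assms unfolding lin_family_def by blast
  then have "locLp p (\<lambda>x. f x + (- 1) * B Q f x)"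
    using assms by (intro locLp_add locLp_cmult)
  then show ?thesis by (simp add: Aop_def)
qed

text \<open>The absorption hypothesis says that \<open>B R\<close> kills \<open>Aop B Q f\<close> on \<open>2R\<close>, so \<open>B R (B Q f) = B R f\<close> there.\<close>
lemma AE_split_on_subcube:
  fixes R Q :: "'n::finite cube"
  assumes lin: "lin_family p B" and p: "0 \<le> p" and Q: "is_cube Q" and R: "is_cube R" and f: "locLp p f"
    and absorb: "AE x in lebesgue. x \<in> cube_set (dil 2 R) \<longrightarrow> Aop B R (Aop B Q f) x = Aop B Q f x"
    and E: "E \<in> sets lebesgue"
  shows "AE x in lebesgue. x \<in> cube_set (dil 2 R) \<longrightarrow> B Q f x = B R f x
    + Aop B R (\<lambda>x. indicator E x * B Q f x) x + Aop B R (\<lambda>x. indicator (UNIV - E) x * B Q f x) x"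
proof -
  let ?h = "B Q f" and ?u = "\<lambda>x. indicator E x * B Q f x" and ?v = "\<lambda>x. indicator (UNIV - E) x * B Q f x"
  have h: "locLp p ?h" using lin Q f unfolding lin_family_def by blast
  have A: "locLp p (Aop B Q f)" using locLp_Aop[OF lin Q f p] .
  have CE: "UNIV - E \<in> sets lebesgue" using sets.compl_sets[OF E] by simp
  have add: "AE x in lebesgue. B R (\<lambda>y. g y + k y) x = B R g x + B R k x"
    if "locLp p g" "locLp p k" for g k
    using lin R that unfolding lin_family_def by blast
  have uv: "(\<lambda>y. ?u y + ?v y) = ?h" by (auto simp: indicator_def)
  \<comment> \<open>Additivity of \<open>B R\<close> is used for two decompositions: of h into its
    parts on and off E, and of f into A_Q f and h.\<close>
  have Ah: "(\<lambda>y. Aop B Q f y + ?h y) = f" by (simp add: Aop_def)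
  show ?thesis
    using add[OF locLp_indicator[OF h E] locLp_indicator[OF h CE]] add[OF A h] absorb
    unfolding uv Ah
  proof eventually_elim
    case (elim x)
    have "?h x = ?u x + ?v x" using fun_cong[OF uv, of x] by simp
    then show ?case using elim by (auto simp: Aop_def)
  qed
qed

lemma ennreal_suminf_shift_le: "(\<Sum>k. f (k + i)) \<le> (\<Sum>k. f k :: ennreal)"
  unfolding suminf_offset[of f i, OF summableI] by simp

text \<open>Each term of (c) splits into alpha_k 2^n t, which sums to at most 2^n S t, and eta_k
  a_k, which sums to at most t by the choice of level; hence 2^n S + 1. Here a_k stands for a(2^k
  Q).\<close>

lemma avgq_tail_le:
  fixes R :: "'n::finite cube" and a :: "nat \<Rightarrow> real"
  assumes c: "cond_c p q0 \<alpha> B" and h: "locLp p h" and R: "is_cube R" and t: "0 \<le> t"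
    and S: "S = (\<Sum>k. 2 powr (real (k + 2) * real CARD('n) / p) * \<alpha> (k + 2))" and p: "0 < p"
    and a: "\<And>k. 0 \<le> a k"
    and avg: "\<And>k. 1 \<le> k \<Longrightarrow> avgp p (cube_set (dil (2 ^ k) R)) h
      \<le> ennreal (2 ^ CARD('n) * t + 2 powr (real k * real CARD('n) / p) * a k)"
    and sum: "(\<Sum>k. ennreal (eta CARD('n) p \<alpha> (k + 1) * a (k + 1))) \<le> ennreal t"
  shows "avgq q0 (cube_set (dil 2 R)) (Aop B R (\<lambda>x. indicator (cube_set (dil 4 R)) x * h x))
      \<le> ennreal ((2 ^ CARD('n) * S + 1) * t)"
    and "avgq q0 (cube_set (dil 2 R)) (Aop B R (\<lambda>x. indicator (UNIV - cube_set (dil 4 R)) x * h x))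
      \<le> ennreal ((2 ^ CARD('n) * S + 1) * t)"
proof -
  let ?n = "CARD('n)"
  let ?w = "\<lambda>k. 2 powr (real (k + 2) * real ?n / p) * \<alpha> (k + 2)"
  note c' = c[unfolded cond_c_def]
  note \<alpha> = c'[THEN conjunct1, rule_format]
  note wsum = c'[THEN conjunct2, THEN conjunct1]
  note near = c'[THEN conjunct2, THEN conjunct2, THEN conjunct1, rule_format, OF R h]
  note far = c'[THEN conjunct2, THEN conjunct2, THEN conjunct2, rule_format, OF R h order.refl]
  have wge: "\<alpha> (k + 2) \<le> ?w k" for k
  proof -
    have "1 \<le> 2 powr (real (k + 2) * real ?n / p)" using p by (intro ge_one_powr_ge_zero) auto
    then have "1 * \<alpha> (k + 2) \<le> ?w k" using \<alpha> by (intro mult_right_mono) auto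
    then show ?thesis by simp
  qed
  have w0: "0 \<le> ?w k" for k using \<alpha> by simp
  let ?A = "\<lambda>k. ennreal (?w k * (2 ^ ?n * t))"
  let ?E = "\<lambda>k. ennreal (eta ?n p \<alpha> (k + 1) * a (k + 1))"
  have Asum: "(\<Sum>k. ?A k) = ennreal (S * (2 ^ ?n * t))"
  proof -
    have "(\<lambda>k. ?w k * (2 ^ ?n * t)) sums (S * (2 ^ ?n * t))"
      unfolding S by (rule sums_mult2[OF summable_sums[OF wsum]])
    then show ?thesis using w0 t by (intro suminf_ennreal_eq) auto
  qed
  have S0: "0 \<le> S" unfolding S using w0 wsum by (intro suminf_nonneg) auto
  \<comment> \<open>Both summands on the right belong to scale k + 2: \<open>?A\<close> counts from
    scale 2 and \<open>?E\<close> from scale 1.\<close>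
  have term_le: "ennreal (\<alpha> (k + 2)) * avgp p (cube_set (dil (2 ^ (k + 2)) R)) h \<le> ?A k + ?E (k + 1)" for k
  proof -
    let ?q = "2 powr (real (k + 2) * real ?n / p)"
    have "ennreal (\<alpha> (k + 2)) * avgp p (cube_set (dil (2 ^ (k + 2)) R)) h
        \<le> ennreal (\<alpha> (k + 2)) * ennreal (2 ^ ?n * t + ?q * a (k + 2))"
      by (intro mult_left_mono avg) auto
    also have "\<dots> = ennreal (\<alpha> (k + 2) * (2 ^ ?n * t + ?q * a (k + 2)))"
      using \<alpha>[of "k + 2"] a t by (intro ennreal_mult[symmetric]) auto
    also have "\<dots> \<le> ennreal (?w k * (2 ^ ?n * t) + eta ?n p \<alpha> (k + 2) * a (k + 2))"
    proof (rule ennreal_leI)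
      have "\<alpha> (k + 2) * (2 ^ ?n * t) \<le> ?w k * (2 ^ ?n * t)"
        using wge t by (intro mult_right_mono) auto
      then show "\<alpha> (k + 2) * (2 ^ ?n * t + ?q * a (k + 2)) \<le> ?w k * (2 ^ ?n * t) + eta ?n p \<alpha> (k + 2) * a (k + 2)"
        by (simp add: eta_def distrib_left mult.assoc)
    qed
    also have "\<dots> = ?A k + ?E (k + 1)"
      using w0[of k] \<alpha>[of "k + 2"] a[of "k + 2"] t
      by (subst ennreal_plus) (auto simp: eta_def numeral_2_eq_2)
    finally show ?thesis .
  qed
  have total: "(\<Sum>k. ?A (k + 1) + ?E (k + 1 + 1)) \<le> ennreal ((2 ^ ?n * S + 1) * t)" "?A 0 + ?E 1 \<le> ennreal ((2 ^ ?n * S + 1) * t)"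
  proof -
    have fin: "(\<Sum>k. ?A k) + (\<Sum>k. ?E k) \<le> ennreal ((2 ^ ?n * S + 1) * t)"
    proof -
      have "(\<Sum>k. ?A k) + (\<Sum>k. ?E k) \<le> ennreal (S * (2 ^ ?n * t)) + ennreal t"
        unfolding Asum by (intro add_mono sum order.refl)
      also have "\<dots> = ennreal ((2 ^ ?n * S + 1) * t)"
        using S0 t by (subst ennreal_plus[symmetric]) (auto simp: algebra_simps)
      finally show ?thesis .
    qed
    have "(\<Sum>k. ?A (k + 1) + ?E (k + 1 + 1)) = (\<Sum>k. ?A (k + 1)) + (\<Sum>k. ?E (k + 2))"
      by (subst suminf_add[symmetric]) (auto simp: numeral_2_eq_2)
    also have "\<dots> \<le> (\<Sum>k. ?A k) + (\<Sum>k. ?E k)"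
      using ennreal_suminf_shift_le[of ?A 1] ennreal_suminf_shift_le[of ?E 2] by (rule add_mono)
    finally show "(\<Sum>k. ?A (k + 1) + ?E (k + 1 + 1)) \<le> ennreal ((2 ^ ?n * S + 1) * t)"
      using fin by (rule order_trans)
    have "?A 0 + ?E 1 \<le> (\<Sum>k. ?A k) + (\<Sum>k. ?E k)"
      using sum_le_suminf[of ?A "{0}"] sum_le_suminf[of ?E "{1}"] by (intro add_mono) auto
    then show "?A 0 + ?E 1 \<le> ennreal ((2 ^ ?n * S + 1) * t)" using fin by (rule order_trans)
  qed
  have "avgq q0 (cube_set (dil 2 R)) (Aop B R (\<lambda>x. indicator (cube_set (dil 4 R)) x * h x))
      \<le> ennreal (\<alpha> 2) * avgp p (cube_set (dil 4 R)) h"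
    by (rule near)
  also have "\<dots> \<le> ?A 0 + ?E 1" using term_le[of 0] by (simp only: add_0 power2_eq_square) (simp add: power2_eq_square)
  finally show "avgq q0 (cube_set (dil 2 R)) (Aop B R (\<lambda>x. indicator (cube_set (dil 4 R)) x * h x))
      \<le> ennreal ((2 ^ ?n * S + 1) * t)" using total(2) by (rule order_trans)
  \<comment> \<open>The far part of (c) with j = 1, whose series begins at scale 3; scale 2 was used
    by the near part.\<close>
  have "avgq q0 (cube_set (dil (2 ^ 1) R)) (Aop B R (\<lambda>x. indicator (UNIV - cube_set (dil (2 ^ (1 + 1)) R)) x * h x))
      \<le> (\<Sum>k. ennreal (\<alpha> (k + 2 + 1)) * avgp p (cube_set (dil (2 ^ (k + 2 + 1)) R)) h)"
    by (rule far)
  also have "\<dots> \<le> (\<Sum>k. ?A (k + 1) + ?E (k + 1 + 1))"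
  proof (intro suminf_le summableI)
    fix k show "ennreal (\<alpha> (k + 2 + 1)) * avgp p (cube_set (dil (2 ^ (k + 2 + 1)) R)) h
        \<le> ?A (k + 1) + ?E (k + 1 + 1)"
      using term_le[of "k + 1"] by (simp only: add.assoc one_add_one add.commute[of 1 2])
  qed
  finally have "avgq q0 (cube_set (dil (2 ^ 1) R)) (Aop B R (\<lambda>x. indicator (UNIV - cube_set (dil (2 ^ (1 + 1)) R)) x * h x))
      \<le> ennreal ((2 ^ ?n * S + 1) * t)" using total(1) by (rule order_trans)
  moreover have "(2::real) ^ (1 + 1) = 4" "(2::real) ^ 1 = 2" by simp_all
  ultimately show "avgq q0 (cube_set (dil 2 R)) (Aop B R (\<lambda>x. indicator (UNIV - cube_set (dil 4 R)) x * h x))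
      \<le> ennreal ((2 ^ ?n * S + 1) * t)" by (simp only:)
qed

subsection \<open>Iteration\<close>

text \<open>The order of choice matters. Since r > q, K can be taken so large that the L^r part is
  at most 1/4; then \<open>\<gamma>\<close> is solved for so that the L^p part equals 1/4 for this
  K. The 2 in the maximum only ensures K > 1.\<close>

lemma good_lambda_constants:
  fixes p q r A b :: real
  assumes "0 < p" "q < r" "0 < A" "0 < b"
  obtains K \<gamma> where "1 < K" "0 < \<gamma>" "K powr q * (A * ((3 * \<gamma> / K) powr p + 2 * (b / K) powr r)) \<le> 1/2"
proof -
  define K where "K = max 2 ((8 * A * b powr r) powr (1 / (r - q)))"
  have K: "1 < K" by (simp add: K_def)
  define \<gamma> where "\<gamma> = K / 3 * (1 / (4 * A * K powr q)) powr (1 / p)"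
  have \<gamma>: "0 < \<gamma>" using K assms by (simp add: \<gamma>_def)
  have g: "(3 * \<gamma> / K) powr p = 1 / (4 * A * K powr q)"
    using K assms by (simp add: \<gamma>_def powr_powr)
  have "8 * A * b powr r \<le> K powr (r - q)"
  proof -
    have "8 * A * b powr r = ((8 * A * b powr r) powr (1 / (r - q))) powr (r - q)"
      using assms by (simp add: powr_powr)
    also have "\<dots> \<le> K powr (r - q)" using assms by (intro powr_mono2) (auto simp: K_def)
    finally show ?thesis .
  qed
  then have "K powr q * (A * (2 * (b / K) powr r)) \<le> 1/4"
    using K assms by (simp add: powr_divide powr_diff field_simps)
  moreover have "K powr q * (A * (3 * \<gamma> / K) powr p) = 1/4"
    unfolding g using K assms by (simp add: field_simps)
  ultimately have "K powr q * (A * ((3 * \<gamma> / K) powr p + 2 * (b / K) powr r)) \<le> 1/2"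
    by (simp add: distrib_left)
  then show ?thesis using that K \<gamma> by blast
qed

text \<open>After rescaling by K^(qj), one step is the map x -> K^q theta x + K^q D V with slope at
  most 1/2. The number (1 + 2 K^q D) V dominates the starting value V and is an upper bound
  preserved by this map.\<close>

lemma geometric_decay:
  fixes \<omega> :: "real \<Rightarrow> real"
  assumes "0 < t0" "1 \<le> K" "0 \<le> V" "0 \<le> D" "\<omega> t0 \<le> V" "0 \<le> \<theta>"
    and step: "\<And>t. t0 \<le> t \<Longrightarrow> \<omega> (K * t) \<le> \<theta> * \<omega> t + D * (t0 / t) powr q * V"
    and \<theta>: "K powr q * \<theta> \<le> 1/2"
  shows "\<omega> (K ^ j * t0) \<le> (1 + 2 * (K powr q * D)) * V * (1 / K powr q) ^ j"
proof (induction j)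
  case 0
  have "1 * V \<le> (1 + 2 * (K powr q * D)) * V" using assms by (intro mult_right_mono) auto
  then show ?case using assms(5) by simp
next
  case (Suc j)
  let ?M = "1 + 2 * (K powr q * D)" and ?x = "1 / K powr q"
  have Kq: "0 < K powr q" using assms by simp
  have x: "0 < ?x" using Kq by simp
  have "1 * t0 \<le> K ^ j * t0" using assms by (intro mult_right_mono one_le_power) auto
  then have "\<omega> (K * (K ^ j * t0)) \<le> \<theta> * \<omega> (K ^ j * t0) + D * (t0 / (K ^ j * t0)) powr q * V"
    by (intro step) simp
  also have "(t0 / (K ^ j * t0)) powr q = ?x ^ j"
    using assms by (simp add: powr_divide powr_power powr_realpow[symmetric] powr_powr mult.commute)
  also have "\<theta> * \<omega> (K ^ j * t0) + D * ?x ^ j * V \<le> \<theta> * (?M * V * ?x ^ j) + D * ?x ^ j * V"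
    using Suc assms(6) by (intro add_right_mono mult_left_mono)
  also have "\<dots> = (K powr q * \<theta> * ?M + K powr q * D) * (V * ?x ^ Suc j)"
    using Kq by (simp add: field_simps)
  also have "\<dots> \<le> ?M * (V * ?x ^ Suc j)"
  proof (rule mult_right_mono)
    have "0 \<le> ?M" using assms Kq by simp
    then have "K powr q * \<theta> * ?M \<le> 1/2 * ?M" using \<theta> by (intro mult_right_mono)
    then show "K powr q * \<theta> * ?M + K powr q * D \<le> ?M" by (simp add: field_simps)
    show "0 \<le> V * ?x ^ Suc j" using assms(3) x by (intro mult_nonneg_nonneg) auto
  qed
  finally show ?case by (simp add: mult.assoc)
qed

section \<open>From decay of the heavy sets to the weak norm\<close>

lemma weak_norm_le:
  fixes Q :: "'n::finite cube"
  assumes Q: "is_cube Q" and q: "0 < q" and A: "0 \<le> A"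
    and dist: "\<And>\<tau>. 0 < \<tau> \<Longrightarrow> emeasure lebesgue {x \<in> cube_set Q. \<tau> < cmod (g x)}
      \<le> ennreal ((A / \<tau>) powr q * measure lebesgue (cube_set Q))"
  shows "weak_norm q Q g \<le> ennreal A"
  unfolding weak_norm_def
proof (rule SUP_least)
  fix \<tau> :: real assume "\<tau> \<in> {0<..}"
  then have \<tau>: "0 < \<tau>" by simp
  let ?v = "measure lebesgue (cube_set Q)"
  have v: "0 < ?v" using measure_cube_pos[OF Q] .
  have "emeasure lebesgue {x \<in> cube_set Q. \<tau> < cmod (g x)} / emeasure lebesgue (cube_set Q)
      \<le> ennreal ((A / \<tau>) powr q * ?v) / ennreal ?v"
    unfolding emeasure_cube_measure[OF Q] by (intro divide_right_mono_ennreal dist \<tau>)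
  also have "\<dots> = ennreal ((A / \<tau>) powr q)" using v by (simp add: divide_ennreal)
  finally have "ennroot q (emeasure lebesgue {x \<in> cube_set Q. \<tau> < cmod (g x)} / emeasure lebesgue (cube_set Q))
      \<le> ennreal (A / \<tau>)" using ennroot_le_iff[OF q, of "A / \<tau>"] A \<tau> by simp
  then have "ennreal \<tau> * ennroot q (emeasure lebesgue {x \<in> cube_set Q. \<tau> < cmod (g x)} / emeasure lebesgue (cube_set Q))
      \<le> ennreal \<tau> * ennreal (A / \<tau>)" by (intro mult_left_mono) auto
  also have "\<dots> = ennreal A" using \<tau> A by (simp add: ennreal_mult'[symmetric])
  finally show "ennreal \<tau> * ennroot q (emeasure lebesgue {x \<in> cube_set Q. \<tau> < cmod (g x)} / emeasure lebesgue (cube_set Q))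
      \<le> ennreal A" .
qed

text \<open>Removes the cap on generations: the truncated heavy sets increase with N, so a bound
  uniform in N passes to their union, which contains almost all of the superlevel set.\<close>

lemma emeasure_superlevel_le:
  fixes Q :: "'n::finite cube"
  assumes Q: "is_cube Q" and p: "1 \<le> p" and s: "0 < s" and h: "h \<in> borel_measurable lebesgue"
    and \<tau>: "2 ^ (CARD('n) + 1) * s \<le> \<tau>"
    and bound: "\<And>N. measure lebesgue (\<Union>P\<in>stopping Q N (heavy p h s). cube_set P) \<le> M"
  shows "emeasure lebesgue {x \<in> cube_set Q. \<tau> < cmod (h x)} \<le> ennreal M"
proof -
  define \<Omega> where "\<Omega> N = (\<Union>P\<in>stopping Q N (heavy p h s). cube_set P)" for N
  have \<Omega>: "\<Omega> N \<in> lmeasurable" for N unfolding \<Omega>_def by (rule lmeasurable_stopped[OF Q])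
  have sub: "stopping Q N bad \<subseteq> stopping Q N' bad" if "N \<le> N'" for N N' and bad :: "'n cube \<Rightarrow> bool"
    using that unfolding stopping_def by (blast intro: order_trans)
  then have mono: "incseq \<Omega>" unfolding incseq_def \<Omega>_def by (meson UN_mono order.refl)
  have "AE x in lebesgue. x \<in> {x \<in> cube_set Q. \<tau> < cmod (h x)} \<longrightarrow> x \<in> (\<Union>N. \<Omega> N)"
    using AE_le_off_heavy[OF Q p s h]
  proof eventually_elim
    case (elim x)
    show ?case
    proof
      assume x: "x \<in> {x \<in> cube_set Q. \<tau> < cmod (h x)}"
      then obtain m where "heavy p h s (dyad Q m x)" using elim \<tau> by fastforce
      then obtain R where "R \<in> stopping Q m (heavy p h s)" "cube_set (dyad Q m x) \<subseteq> cube_set R"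
        using exists_stopping[OF Q, of x m m] x by blast
      then show "x \<in> (\<Union>N. \<Omega> N)" using mem_dyad[OF Q, of x m] unfolding \<Omega>_def by blast
    qed
  qed
  then have "emeasure lebesgue {x \<in> cube_set Q. \<tau> < cmod (h x)} \<le> emeasure lebesgue (\<Union>N. \<Omega> N)"
    using \<Omega> by (intro emeasure_mono_AE sets.countable_UN) auto
  also have "\<dots> = (SUP N. emeasure lebesgue (\<Omega> N))"
    using \<Omega> mono by (intro SUP_emeasure_incseq[symmetric]) auto
  also have "\<dots> \<le> ennreal M"
  proof (rule SUP_least)
    fix N show "emeasure lebesgue (\<Omega> N) \<le> ennreal M"
      unfolding emeasure_eq_measure2[OF \<Omega>] using bound[of N] by (intro ennreal_leI) (simp add: \<Omega>_def)
  qed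
  finally show ?thesis .
qed

text \<open>The decay is known only at the levels K^j t0, and a level between two of them is
  compared with the lower one at the price of a factor K. The factor 2^(n+1) converts heaviness into
  size of h, and M^(1/q) undoes the q-th power.\<close>

lemma weak_norm_le_of_decay:
  fixes Q :: "'n::finite cube"
  assumes Q: "is_cube Q" and p: "1 \<le> p" and q: "0 < q" and h: "h \<in> borel_measurable lebesgue"
    and t0: "0 < t0" and K: "1 < K" and M: "1 \<le> M"
    and decay: "\<And>N j. measure lebesgue (\<Union>P\<in>stopping Q N (heavy p h (K ^ j * t0)). cube_set P)
      \<le> M * measure lebesgue (cube_set Q) * (1 / K powr q) ^ j"
  shows "weak_norm q Q h \<le> ennreal (M powr (1 / q) * K * 2 ^ (CARD('n) + 1) * t0)"
proof (rule weak_norm_le[OF Q q])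
  let ?c = "2 ^ (CARD('n) + 1) :: real" and ?v = "measure lebesgue (cube_set Q)"
  let ?A = "M powr (1 / q) * K * ?c * t0"
  show "0 \<le> ?A" using K t0 by simp
  fix \<tau> :: real assume \<tau>: "0 < \<tau>"
  have A: "(?A / \<tau>) powr q = M * (K * (?c * t0) / \<tau>) powr q"
  proof -
    have "?A / \<tau> = M powr (1 / q) * (K * (?c * t0) / \<tau>)" by simp
    also have "\<dots> powr q = M * (K * (?c * t0) / \<tau>) powr q"
      using K t0 \<tau> q M by (subst powr_mult) (auto simp: powr_powr)
    finally show ?thesis .
  qed
  show "emeasure lebesgue {x \<in> cube_set Q. \<tau> < cmod (h x)} \<le> ennreal ((?A / \<tau>) powr q * ?v)"
  proof (cases "\<tau> < ?c * t0")
    case True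
    have "1 * (?c * t0) \<le> K * (?c * t0)" using K t0 by (intro mult_right_mono) auto
    then have "\<tau> \<le> K * (?c * t0)" using True by linarith
    then have "1 \<le> K * (?c * t0) / \<tau>" using \<tau> by (simp only: le_divide_eq_1_pos)
    then have "1 \<le> (K * (?c * t0) / \<tau>) powr q" using q by (intro ge_one_powr_ge_zero) auto
    then have "1 * 1 \<le> M * (K * (?c * t0) / \<tau>) powr q" using M by (intro mult_mono) auto
    then have "1 * ?v \<le> (?A / \<tau>) powr q * ?v" unfolding A by (intro mult_right_mono) auto
    then have "ennreal ?v \<le> ennreal ((?A / \<tau>) powr q * ?v)" by (intro ennreal_leI) simp
    moreover have "emeasure lebesgue {x \<in> cube_set Q. \<tau> < cmod (h x)} \<le> ennreal ?v"
      unfolding emeasure_cube_measure[OF Q, symmetric] using sets_cube[OF Q] by (intro emeasure_mono) auto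
    ultimately show ?thesis by (rule order_trans[rotated])
  next
    case False
    have ex: "\<exists>j. \<tau> < K ^ j * (?c * t0)"
    proof -
      obtain j where "\<tau> / (?c * t0) < K ^ j" using real_arch_pow[OF K] by blast
      then show ?thesis using t0 by (auto simp: divide_less_eq intro!: exI[of _ j])
    qed
    \<comment> \<open>Here k is at least 1, so tau lies between levels k - 1 and k; smaller tau were
      settled by the trivial bound |Q|.\<close>
    define k where "k = (LEAST j. \<tau> < K ^ j * (?c * t0))"
    have k: "\<tau> < K ^ k * (?c * t0)" unfolding k_def by (rule LeastI_ex[OF ex])
    have "k \<noteq> 0" using k False by (intro notI) simp
    then obtain j where j: "k = Suc j" using not0_implies_Suc by blast
    have "\<not> \<tau> < K ^ j * (?c * t0)" using j unfolding k_def by (intro not_less_Least) simp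
    then have "?c * (K ^ j * t0) \<le> \<tau>" by (simp add: not_less mult_ac)
    then have "emeasure lebesgue {x \<in> cube_set Q. \<tau> < cmod (h x)} \<le> ennreal (M * ?v * (1 / K powr q) ^ j)"
      using K t0 by (intro emeasure_superlevel_le[OF Q p _ h _ decay]) auto
    also have "\<dots> \<le> ennreal ((?A / \<tau>) powr q * ?v)"
    proof (rule ennreal_leI)
      have Kj: "(1 / K powr q) ^ j = (1 / K ^ j) powr q"
        using K by (simp add: powr_divide powr_power powr_realpow[symmetric] powr_powr mult.commute)
      have "1 / K ^ j \<le> K * (?c * t0) / \<tau>"
        using k K \<tau> unfolding j by (simp add: field_simps)
      then have "(1 / K powr q) ^ j \<le> (K * (?c * t0) / \<tau>) powr q"
        unfolding Kj using K q by (intro powr_mono2) auto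
      then have "(M * ?v) * (1 / K powr q) ^ j \<le> (M * ?v) * (K * (?c * t0) / \<tau>) powr q"
        using M by (intro mult_left_mono) auto
      then show "M * ?v * (1 / K powr q) ^ j \<le> (?A / \<tau>) powr q * ?v" unfolding A by (simp add: mult_ac)
    qed
    finally show ?thesis .
  qed
qed


text \<open>Supplies the local bound for h = B_Q f. The hypothesis that t dominates the weighted sum
  of the a(2^k Q) is what gives the nonlocal terms size comparable to t.\<close>

lemma stopped_decay_step:
  fixes Q :: "'n::finite cube" and a :: "'n cube \<Rightarrow> real"
  assumes p: "1 \<le> p" "p < q" "q < r"
    and r: "\<And>(P :: 'n cube) g c c'. is_cube P \<Longrightarrow> 0 \<le> c \<Longrightarrow> c < c' \<Longrightarrow>
      avgq q0 (cube_set P) g \<le> ennreal c \<Longrightarrow>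
      pint r (cube_set P) g \<le> ennreal (c' powr r * measure lebesgue (cube_set P))"
    and lin: "lin_family p B" and cc: "cond_c p q0 \<alpha> B"
    and absorb: "\<And>R. is_cube R \<Longrightarrow> cube_set R \<subseteq> cube_set Q \<Longrightarrow>
      AE x in lebesgue. x \<in> cube_set (dil 2 R) \<longrightarrow> Aop B R (Aop B Q f) x = Aop B Q f x"
    and f: "locLp p f" and a: "\<And>P. is_cube P \<Longrightarrow> 0 \<le> a P"
    and avg: "\<And>P k. is_cube P \<Longrightarrow>
      avgp p (cube_set (dil (2 ^ k) P)) (B P f) \<le> ennreal (a (dil (2 ^ k) P))"
    and Dq: "in_Dq_with q Ca a" and Q: "is_cube Q" and t: "0 < t"
    and sum: "(\<Sum>k. ennreal (eta CARD('n) p \<alpha> (k + 1) * a (dil (2 ^ (k + 1)) Q))) \<le> ennreal t"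
    and S: "S = (\<Sum>k. 2 powr (real (k + 2) * real CARD('n) / p) * \<alpha> (k + 2))" "0 \<le> S"
    and K: "1 < K" "0 < \<gamma>"
  shows "measure lebesgue (\<Union>P\<in>stopping Q N (heavy p (B Q f) (K * t)). cube_set P)
    \<le> 6 ^ CARD('n) * 2 * ((3 * \<gamma> / K) powr p + 2 * (24 * (2 ^ CARD('n) * S + 1) / K) powr r)
        * measure lebesgue (\<Union>P\<in>stopping Q N (heavy p (B Q f) t). cube_set P)
      + 6 ^ CARD('n) * Ca powr q * (a (dil 2 Q) / (\<gamma> * t)) powr q * measure lebesgue (cube_set Q)"
proof (rule good_lambda[OF Q t])
  let ?h = "B Q f" and ?C = "2 ^ CARD('n) * S + 1"
  have C: "0 < ?C" using S(2) by (simp add: add_nonneg_pos)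
  have h: "locLp p ?h" using lin Q f unfolding lin_family_def by blast
  fix R F
  assume R: "R \<in> stopping Q N (heavy p ?h t)" and aR: "a (dil 2 R) \<le> \<gamma> * t" and F: "finite F"
    "\<And>P. P \<in> F \<Longrightarrow> is_cube P \<and> cube_set P \<subseteq> cube_set R \<and> heavy p ?h (K * t) P"
  obtain m x where x: "R = dyad Q m x" "x \<in> cube_set Q" "\<And>m'. m' < m \<Longrightarrow> \<not> heavy p ?h t (dyad Q m' x)"
    using R by (blast elim: stoppingE)
  have Rc: "is_cube R" "cube_set R \<subseteq> cube_set Q"
    using is_cube_stopping[OF Q R] stopping_subset[OF Q R] by auto
  have R2: "is_cube (dil 2 R)" and R4: "is_cube (dil 4 R)" using Rc by simp_all
  let ?E = "cube_set (dil 4 R)"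
  let ?g1 = "Aop B R (\<lambda>x. indicator ?E x * ?h x)" and ?g2 = "Aop B R (\<lambda>x. indicator (UNIV - ?E) x * ?h x)"
  have E: "?E \<in> sets lebesgue" "UNIV - ?E \<in> sets lebesgue"
    using sets_cube[OF R4] sets.compl_sets[OF sets_cube[OF R4]] by simp_all
  have avgR: "avgp p (cube_set (dil (2 ^ k) R)) ?h
      \<le> ennreal (2 ^ CARD('n) * t + 2 powr (real k * real CARD('n) / p) * a (dil (2 ^ k) Q))"
    if "1 \<le> k" for k
    unfolding x(1)
    by (rule avgp_dilated_stopping_le[OF Q x(2) p(1) _ that x(3) avg[OF Q]]) (use t a Q in auto)
  have tail: "avgq q0 (cube_set (dil 2 R)) ?g1 \<le> ennreal (?C * t)"
    "avgq q0 (cube_set (dil 2 R)) ?g2 \<le> ennreal (?C * t)"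
    using avgq_tail_le[OF cc h Rc(1) _ S(1) _ _ avgR sum] t p a Q by simp_all
  \<comment> \<open>The strict slack required for \<open>r\<close> is bought by doubling the bound,
    which turns the 12 of the local estimate into 24.\<close>
  have "0 < ?C * t" using C t by (rule mult_pos_pos)
  then have Ct: "0 \<le> ?C * t" "?C * t < 2 * ?C * t" by linarith+
  have p0: "0 \<le> p" using p by simp
  have loc: "locLp p (B R f)" "locLp p ?g1" "locLp p ?g2"
    using lin Rc(1) f locLp_Aop[OF lin Rc(1) locLp_indicator[OF h E(1)] p0]
      locLp_Aop[OF lin Rc(1) locLp_indicator[OF h E(2)] p0] unfolding lin_family_def by blast+
  have "avgp p (cube_set (dil 2 R)) (B R f) \<le> ennreal (a (dil 2 R))"
    using avg[OF Rc(1), of 1] by simp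
  also have "\<dots> \<le> ennreal (\<gamma> * t)" using aR by (rule ennreal_leI)
  finally have b: "pint p (cube_set (dil 2 R)) (B R f)
      \<le> ennreal ((\<gamma> * t) powr p * measure lebesgue (cube_set (dil 2 R)))"
    using avgp_le_iff[OF R2, of p "\<gamma> * t"] p K t by simp
  have "measure lebesgue (\<Union>P\<in>F. cube_set P)
      \<le> 6 ^ CARD('n) * 2 * ((3 * (\<gamma> * t) / (K * t)) powr p + 2 * (12 * (2 * ?C * t) / (K * t)) powr r)
        * measure lebesgue (cube_set R)"
  proof (rule heavy_subcubes_measure_le[OF p(1) _ _ Rc(1) _ _ _ _
        AE_split_on_subcube[OF lin p0 Q Rc(1) f absorb[OF Rc] E(1)] F(1) _ _ _ b
        r[OF R2 Ct tail(1)] r[OF R2 Ct tail(2)]])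
    show "p \<le> r" "0 < K * t" "0 \<le> \<gamma> * t" using p K t by simp_all
    show "0 \<le> 2 * ?C * t" using Ct by linarith
    show "is_cube P" "cube_set P \<subseteq> cube_set R" "heavy p ?h (K * t) P" if "P \<in> F" for P
      using F(2)[OF that] by auto
  qed (use h loc in \<open>simp_all add: locLp_def\<close>)
  also have "3 * (\<gamma> * t) / (K * t) = 3 * \<gamma> / K" using t by simp
  also have "12 * (2 * ?C * t) / (K * t) = 24 * ?C / K" using t by simp
  finally show "measure lebesgue (\<Union>P\<in>F. cube_set P)
      \<le> 6 ^ CARD('n) * 2 * ((3 * \<gamma> / K) powr p + 2 * (24 * ?C / K) powr r) * measure lebesgue (cube_set R)" .
qed (use p K Dq a in auto)

text \<open>The order \<open>Ca\<close>, then \<open>C\<close>, then f and a expresses uniformity: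
  with B and the exponents fixed, the constant sees the functional only through a D_q
  constant.\<close>

theorem mainTheorem4:
  fixes B :: "'n::finite cube \<Rightarrow> (real^'n \<Rightarrow> complex) \<Rightarrow> (real^'n \<Rightarrow> complex)"
    and p0 q Cp0 :: real and q0 :: ennreal and \<alpha> :: "nat \<Rightarrow> real"
  assumes "1 \<le> p0" and "p0 < q" and "ennreal q < q0"
    and "lin_family p0 B"
    and "cond_b p0 Cp0 B"
    and "cond_c p0 q0 \<alpha> B"
    and "\<forall>Q R f. is_cube Q \<longrightarrow> is_cube R \<longrightarrow> cube_set R \<subseteq> cube_set Q \<longrightarrow> locLp p0 f \<longrightarrow>
           (AE x in lebesgue. x \<in> cube_set (dil 2 R) \<longrightarrow>
              Aop B R (Aop B Q f) x = Aop B Q f x)"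
  shows "\<forall>Ca. \<exists>C::real. \<forall>f a.
           locLp p0 f \<longrightarrow>
           (\<forall>Q. is_cube Q \<longrightarrow> a Q \<ge> 0) \<longrightarrow>
           (\<forall>Q k. is_cube Q \<longrightarrow> avgp p0 (cube_set (dil (2 ^ k) Q)) (B Q f) \<le> ennreal (a (dil (2 ^ k) Q))) \<longrightarrow>
           in_Dq_with q Ca a \<longrightarrow>
           (\<forall>Q. is_cube Q \<longrightarrow>
              weak_norm q Q (B Q f)
                \<le> ennreal C * (\<Sum>k. ennreal (eta CARD('n) p0 \<alpha> (k + 1) * a (dil (2 ^ (k + 1)) Q))))"
proof
  fix Ca :: real
  let ?n = "CARD('n)"
  have q: "0 < q" using assms(1,2) by simp
  obtain r where r: "q < r" and rint:
    "\<And>(P :: 'n cube) g c c'. is_cube P \<Longrightarrow> 0 \<le> c \<Longrightarrow> c < c' \<Longrightarrow>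
      avgq q0 (cube_set P) g \<le> ennreal c \<Longrightarrow>
      pint r (cube_set P) g \<le> ennreal (c' powr r * measure lebesgue (cube_set P))"
    using avgq_imp_pint[OF assms(3) q] by blast
  define S where "S = (\<Sum>k. 2 powr (real (k + 2) * real ?n / p0) * \<alpha> (k + 2))"
  note cc = assms(6)[unfolded cond_c_def]
  have S0: "0 \<le> S"
    unfolding S_def using cc[THEN conjunct1] by (intro suminf_nonneg cc[THEN conjunct2, THEN conjunct1]) auto
  let ?b = "24 * (2 ^ ?n * S + 1)"
  have b: "0 < ?b" using S0 by (simp add: add_nonneg_pos)
  obtain K \<gamma> where K: "1 < K" "0 < \<gamma>"
    and \<theta>: "K powr q * (6 ^ ?n * 2 * ((3 * \<gamma> / K) powr p0 + 2 * (?b / K) powr r)) \<le> 1/2"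
    by (rule good_lambda_constants[of p0 q r "6 ^ ?n * 2" ?b]) (use assms(1) r b in auto)
  define D where "D = 6 ^ ?n * Ca powr q * (1 / \<gamma>) powr q"
  define M where "M = 1 + 2 * (K powr q * D)"
  have D: "0 \<le> D" by (simp add: D_def)
  then have M: "1 \<le> M" by (simp add: M_def)
  define C where "C = M powr (1 / q) * K * 2 ^ (?n + 1)"
  have C: "0 < C" using K M by (simp add: C_def)
  have "weak_norm q Q (B Q f)
      \<le> ennreal C * (\<Sum>k. ennreal (eta ?n p0 \<alpha> (k + 1) * a (dil (2 ^ (k + 1)) Q)))"
    if f: "locLp p0 f" and a: "\<forall>Q. is_cube Q \<longrightarrow> a Q \<ge> 0"
      and avg: "\<forall>Q k. is_cube Q \<longrightarrow> avgp p0 (cube_set (dil (2 ^ k) Q)) (B Q f) \<le> ennreal (a (dil (2 ^ k) Q))"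
      and Dq: "in_Dq_with q Ca a" and Q: "is_cube Q" for f a Q
  proof -
    let ?T = "\<lambda>k. ennreal (eta ?n p0 \<alpha> (k + 1) * a (dil (2 ^ (k + 1)) Q))"
    let ?\<omega> = "\<lambda>N t. measure lebesgue (\<Union>P\<in>stopping Q N (heavy p0 (B Q f) t). cube_set P)"
    let ?V = "measure lebesgue (cube_set Q)"
    have "locLp p0 (B Q f)" using assms(4) f Q unfolding lin_family_def by blast
    then have h: "B Q f \<in> borel_measurable lebesgue" by (simp add: locLp_def)
    \<comment> \<open>The term k = 0 has weight eta_1 = 1, so any level above the sum also dominates
      the a(2Q) coming from D_q.\<close>
    have a2: "ennreal (a (dil 2 Q)) \<le> (\<Sum>k. ?T k)"
      using sum_le_suminf[of ?T "{0}"] by (simp add: eta_def)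
    have bound: "weak_norm q Q (B Q f) \<le> ennreal (C * t0)" if t0: "0 < t0" "(\<Sum>k. ?T k) \<le> ennreal t0" for t0
    proof -
      have a2t: "a (dil 2 Q) \<le> t0" using order_trans[OF a2 t0(2)] t0(1) by (simp add: ennreal_le_iff)
      have a2n: "0 \<le> a (dil 2 Q)" using a[rule_format, of "dil 2 Q"] Q by simp
      have "?\<omega> N (K ^ j * t0) \<le> M * ?V * (1 / K powr q) ^ j" for N j
        unfolding M_def
      proof (rule geometric_decay[OF t0(1) _ _ D _ _ _ \<theta>])
        fix t assume t: "t0 \<le> t"
        have "(\<Sum>k. ?T k) \<le> ennreal t" using t0(2) ennreal_leI[OF t] by (rule order_trans)
        then have "?\<omega> N (K * t) \<le> 6 ^ ?n * 2 * ((3 * \<gamma> / K) powr p0 + 2 * (?b / K) powr r) * ?\<omega> N t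
            + 6 ^ ?n * Ca powr q * (a (dil 2 Q) / (\<gamma> * t)) powr q * ?V"
          using t t0(1)
          by (intro stopped_decay_step[OF assms(1,2) r rint assms(4,6) _ f _ _ Dq Q _ _ S_def S0 K]
              assms(7)[rule_format, OF Q _ _ f] a[rule_format] avg[rule_format]) simp_all
        moreover have "6 ^ ?n * Ca powr q * (a (dil 2 Q) / (\<gamma> * t)) powr q * ?V \<le> D * (t0 / t) powr q * ?V"
        proof -
          have "a (dil 2 Q) / (\<gamma> * t) \<le> t0 / (\<gamma> * t)"
            using a2t t t0 K by (intro divide_right_mono) auto
          then have "(a (dil 2 Q) / (\<gamma> * t)) powr q \<le> (1 / \<gamma> * (t0 / t)) powr q"
            using a2n t t0 K q by (intro powr_mono2) auto
          also have "\<dots> = (1 / \<gamma>) powr q * (t0 / t) powr q" by (rule powr_mult)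
          finally show ?thesis unfolding D_def mult.assoc
            by (intro mult_left_mono) (auto simp: mult.assoc[symmetric] intro: mult_right_mono)
        qed
        ultimately show "?\<omega> N (K * t) \<le> 6 ^ ?n * 2 * ((3 * \<gamma> / K) powr p0 + 2 * (?b / K) powr r) * ?\<omega> N t
            + D * (t0 / t) powr q * ?V" by linarith
      qed (use K measure_stopped_le[OF Q] in auto)
      then show ?thesis unfolding C_def
        by (rule weak_norm_le_of_decay[OF Q assms(1) q h t0(1) K(1) M])
    qed
    show ?thesis
    proof (cases "\<Sum>k. ?T k")
      case (real s)
      show ?thesis unfolding real
      \<comment> \<open>The sum may vanish while the iteration needs a positive starting level, so
        it starts at s + e / C and e tends to 0.\<close>
      proof (rule ennreal_le_epsilon)
        fix e :: real assume e: "0 < e"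
        have "weak_norm q Q (B Q f) \<le> ennreal (C * (s + e / C))"
          using real e C by (intro bound) (auto intro!: ennreal_leI add_nonneg_pos)
        also have "\<dots> = ennreal C * ennreal s + ennreal e"
          using real e C by (simp add: distrib_left ennreal_mult)
        finally show "weak_norm q Q (B Q f) \<le> ennreal C * ennreal s + ennreal e" .
      qed
    next
      case top
      have "ennreal C * top = top" using C by (simp add: ennreal_mult_top)
      then show ?thesis unfolding top by simp
    qed
  qed
  then show "\<exists>C::real. \<forall>f a.
           locLp p0 f \<longrightarrow>
           (\<forall>Q. is_cube Q \<longrightarrow> a Q \<ge> 0) \<longrightarrow>
           (\<forall>Q k. is_cube Q \<longrightarrow> avgp p0 (cube_set (dil (2 ^ k) Q)) (B Q f) \<le> ennreal (a (dil (2 ^ k) Q))) \<longrightarrow>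
           in_Dq_with q Ca a \<longrightarrow>
           (\<forall>Q. is_cube Q \<longrightarrow>
              weak_norm q Q (B Q f)
                \<le> ennreal C * (\<Sum>k. ennreal (eta CARD('n) p0 \<alpha> (k + 1) * a (dil (2 ^ (k + 1)) Q))))"
    by (intro exI[of _ C]) blast
qed

end
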